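(* Let $K$ be a commutative ring and let $\mathcal T$ be a $K$-linear triangulated category (with shift functor $[1]$) which satisfies one of the following two hypotheses: (a) idempotents split in $\mathcal T$ and the endomorphism algebras of all objects of $\mathcal T$ are artinian; (b) $\mathcal T$ is the category of compact objects in an algebraic compactly generated triangulated $K$-category. Then for any objects $M,N$ of $\mathcal T$, the following assertions are equivalent: (1) There is an object $Z_\ell$ of $\mathcal T$ and a distinguished triangle in $\mathcal T$ $$Z_\ell\stackrel{\begin{pmatrix} v_\ell\\ u_\ell\end{pmatrix}}{\longrightarrow} Z_\ell\oplus M\longrightarrow N\longrightarrow Z_\ell[1],$$ where $v_\ell$ is a nilpotent endomorphism of $Z_\ell$. (2) There is an object $Z_r$ of $\mathcal T$ and a distinguished triangle in $\mathcal T$ $$N\longrightarrow M\oplus Z_r\stackrel{\begin{pmatrix} u_r & v_r\end{pmatrix}}{\longrightarrow} Z_r\longrightarrow N[1],$$ where $v_r$ is a nilpotent endomorphism of $Z_r$.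
   Context: "Artinian ring" means left and right artinian. A triangulated $K$-category is algebraic if it is equivalent, as a triangulated category, to the stable category of a ($K$-linear) Frobenius exact category. An object $C$ of a triangulated category $\mathcal S$ with arbitrary set-indexed coproducts is compact if $\mathrm{Hom}_{\mathcal S}(C,?)$ preserves arbitrary coproducts. A triangulated category $\mathcal S$ is compactly generated if it has arbitrary set-indexed coproducts and there is a set $\mathcal C$ of compact objects such that the only object $X$ with $\mathrm{Hom}_{\mathcal S}(C[n],X)=0$ for all $C\in\mathcal C$, $n\in\mathbb Z$ is $X=0$. *)

theory Defs
  imports "HOL-Algebra.Module" "HOL-Algebra.AbelCoset"
begin

unbundle cardinal_syntax

section \<open>Linear categories\<close>

text \<open>
  Each \<open>Hom C X Y\<close> is a module record of the library; its fields \<open>mult\<close> and \<open>one\<close> carry no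
  meaning. \<open>Cmp C X Y Z g f\<close> is the composite of \<open>f : X \<rightarrow> Y\<close> and \<open>g : Y \<rightarrow> Z\<close>. Since composition,
  identities and functors are told the objects involved, different Hom sets need not be disjoint.
\<close>

record ('k, 'o, 'm) lcat =
  Ob :: "'o set"
  Hom :: "'o \<Rightarrow> 'o \<Rightarrow> ('k, 'm) module"
  Cmp :: "'o \<Rightarrow> 'o \<Rightarrow> 'o \<Rightarrow> 'm \<Rightarrow> 'm \<Rightarrow> 'm"
  Idt :: "'o \<Rightarrow> 'm"

abbreviation mor :: "('k, 'o, 'm, 'z) lcat_scheme \<Rightarrow> 'o \<Rightarrow> 'o \<Rightarrow> 'm set"
  where "mor C X Y \<equiv> carrier (Hom C X Y)"

abbreviation zero_mor :: "('k, 'o, 'm, 'z) lcat_scheme \<Rightarrow> 'o \<Rightarrow> 'o \<Rightarrow> 'm"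
  where "zero_mor C X Y \<equiv> \<zero>\<^bsub>Hom C X Y\<^esub>"

locale linear_category =
  fixes K :: "('k, 'x) ring_scheme" and C :: "('k, 'o, 'm, 'z) lcat_scheme"
  assumes hom_module: "\<lbrakk>X \<in> Ob C; Y \<in> Ob C\<rbrakk> \<Longrightarrow> module K (Hom C X Y)"
    and idt_closed: "X \<in> Ob C \<Longrightarrow> Idt C X \<in> mor C X X"
    and cmp_closed: "\<lbrakk>X \<in> Ob C; Y \<in> Ob C; Z \<in> Ob C; f \<in> mor C X Y; g \<in> mor C Y Z\<rbrakk>
      \<Longrightarrow> Cmp C X Y Z g f \<in> mor C X Z"
    and idt_left: "\<lbrakk>X \<in> Ob C; Y \<in> Ob C; f \<in> mor C X Y\<rbrakk> \<Longrightarrow> Cmp C X Y Y (Idt C Y) f = f"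
    and idt_right: "\<lbrakk>X \<in> Ob C; Y \<in> Ob C; f \<in> mor C X Y\<rbrakk> \<Longrightarrow> Cmp C X X Y f (Idt C X) = f"
    and cmp_assoc: "\<lbrakk>W \<in> Ob C; X \<in> Ob C; Y \<in> Ob C; Z \<in> Ob C;
        f \<in> mor C W X; g \<in> mor C X Y; h \<in> mor C Y Z\<rbrakk>
      \<Longrightarrow> Cmp C W X Z (Cmp C X Y Z h g) f = Cmp C W Y Z h (Cmp C W X Y g f)"
    and cmp_add_left: "\<lbrakk>X \<in> Ob C; Y \<in> Ob C; Z \<in> Ob C; f \<in> mor C X Y; g \<in> mor C Y Z; g' \<in> mor C Y Z\<rbrakk>
      \<Longrightarrow> Cmp C X Y Z (g \<oplus>\<^bsub>Hom C Y Z\<^esub> g') f = Cmp C X Y Z g f \<oplus>\<^bsub>Hom C X Z\<^esub> Cmp C X Y Z g' f"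
    and cmp_add_right: "\<lbrakk>X \<in> Ob C; Y \<in> Ob C; Z \<in> Ob C; f \<in> mor C X Y; f' \<in> mor C X Y; g \<in> mor C Y Z\<rbrakk>
      \<Longrightarrow> Cmp C X Y Z g (f \<oplus>\<^bsub>Hom C X Y\<^esub> f') = Cmp C X Y Z g f \<oplus>\<^bsub>Hom C X Z\<^esub> Cmp C X Y Z g f'"
    and cmp_smult_left: "\<lbrakk>X \<in> Ob C; Y \<in> Ob C; Z \<in> Ob C; f \<in> mor C X Y; g \<in> mor C Y Z; c \<in> carrier K\<rbrakk>
      \<Longrightarrow> Cmp C X Y Z (c \<odot>\<^bsub>Hom C Y Z\<^esub> g) f = c \<odot>\<^bsub>Hom C X Z\<^esub> Cmp C X Y Z g f"
    and cmp_smult_right: "\<lbrakk>X \<in> Ob C; Y \<in> Ob C; Z \<in> Ob C; f \<in> mor C X Y; g \<in> mor C Y Z; c \<in> carrier K\<rbrakk>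
      \<Longrightarrow> Cmp C X Y Z g (c \<odot>\<^bsub>Hom C X Y\<^esub> f) = c \<odot>\<^bsub>Hom C X Z\<^esub> Cmp C X Y Z g f"

definition is_iso :: "('k, 'o, 'm, 'z) lcat_scheme \<Rightarrow> 'o \<Rightarrow> 'o \<Rightarrow> 'm \<Rightarrow> bool" where
  "is_iso C X Y f \<longleftrightarrow> f \<in> mor C X Y \<and>
     (\<exists>g\<in>mor C Y X. Cmp C X Y X g f = Idt C X \<and> Cmp C Y X Y f g = Idt C Y)"

definition isomorphic :: "('k, 'o, 'm, 'z) lcat_scheme \<Rightarrow> 'o \<Rightarrow> 'o \<Rightarrow> bool" where
  "isomorphic C X Y \<longleftrightarrow> X \<in> Ob C \<and> Y \<in> Ob C \<and> (\<exists>f. is_iso C X Y f)"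

definition is_zero_object :: "('k, 'o, 'm, 'z) lcat_scheme \<Rightarrow> 'o \<Rightarrow> bool" where
  "is_zero_object C Z \<longleftrightarrow> Z \<in> Ob C \<and>
     (\<forall>X\<in>Ob C. mor C X Z = {zero_mor C X Z} \<and> mor C Z X = {zero_mor C Z X})"

text \<open>\<open>P\<close> is the direct sum \<open>X \<oplus> Y\<close>, with injections \<open>i1\<close>, \<open>i2\<close> and projections \<open>p1\<close>, \<open>p2\<close>.\<close>

definition biproduct ::
  "('k, 'o, 'm, 'z) lcat_scheme \<Rightarrow> 'o \<Rightarrow> 'o \<Rightarrow> 'o \<Rightarrow> 'm \<Rightarrow> 'm \<Rightarrow> 'm \<Rightarrow> 'm \<Rightarrow> bool" where
  "biproduct C X Y P i1 i2 p1 p2 \<longleftrightarrow> P \<in> Ob C \<and>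
     i1 \<in> mor C X P \<and> i2 \<in> mor C Y P \<and> p1 \<in> mor C P X \<and> p2 \<in> mor C P Y \<and>
     Cmp C X P X p1 i1 = Idt C X \<and> Cmp C Y P Y p2 i2 = Idt C Y \<and>
     Cmp C Y P X p1 i2 = zero_mor C Y X \<and> Cmp C X P Y p2 i1 = zero_mor C X Y \<and>
     Cmp C P X P i1 p1 \<oplus>\<^bsub>Hom C P P\<^esub> Cmp C P Y P i2 p2 = Idt C P"

locale additive_category = linear_category +
  assumes zero_object: "\<exists>Z. is_zero_object C Z"
    and biproducts: "\<lbrakk>X \<in> Ob C; Y \<in> Ob C\<rbrakk> \<Longrightarrow> \<exists>P i1 i2 p1 p2. biproduct C X Y P i1 i2 p1 p2"

definition idempotents_split :: "('k, 'o, 'm, 'z) lcat_scheme \<Rightarrow> bool" where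
  "idempotents_split C \<longleftrightarrow> (\<forall>X\<in>Ob C. \<forall>e\<in>mor C X X. Cmp C X X X e e = e \<longrightarrow>
     (\<exists>Y\<in>Ob C. \<exists>r\<in>mor C X Y. \<exists>s\<in>mor C Y X. Cmp C Y X Y r s = Idt C Y \<and> Cmp C X Y X s r = e))"

definition End_ring :: "('k, 'o, 'm, 'z) lcat_scheme \<Rightarrow> 'o \<Rightarrow> 'm ring" where
  "End_ring C X = \<lparr>carrier = mor C X X, mult = Cmp C X X X, one = Idt C X,
     zero = zero_mor C X X, add = add (Hom C X X)\<rparr>"

definition nilpotent_endo :: "('k, 'o, 'm, 'z) lcat_scheme \<Rightarrow> 'o \<Rightarrow> 'm \<Rightarrow> bool" where
  "nilpotent_endo C X v \<longleftrightarrow> v \<in> mor C X X \<and> (\<exists>n::nat. v [^]\<^bsub>End_ring C X\<^esub> n = zero_mor C X X)"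

text \<open>The two-entry column into \<open>X \<oplus> Y = P\<close> and the two-entry row out of \<open>X \<oplus> Y = P\<close>.\<close>

definition column ::
  "('k, 'o, 'm, 'z) lcat_scheme \<Rightarrow> 'o \<Rightarrow> 'o \<Rightarrow> 'o \<Rightarrow> 'o \<Rightarrow> 'm \<Rightarrow> 'm \<Rightarrow> 'm \<Rightarrow> 'm \<Rightarrow> 'm" where
  "column C W X Y P i1 i2 a b = Cmp C W X P i1 a \<oplus>\<^bsub>Hom C W P\<^esub> Cmp C W Y P i2 b"

definition row ::
  "('k, 'o, 'm, 'z) lcat_scheme \<Rightarrow> 'o \<Rightarrow> 'o \<Rightarrow> 'o \<Rightarrow> 'o \<Rightarrow> 'm \<Rightarrow> 'm \<Rightarrow> 'm \<Rightarrow> 'm \<Rightarrow> 'm" where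
  "row C X Y P W p1 p2 a b = Cmp C P X W a p1 \<oplus>\<^bsub>Hom C P W\<^esub> Cmp C P Y W b p2"

section \<open>Artinian rings\<close>

definition left_ideal :: "'a set \<Rightarrow> ('a, 'b) ring_scheme \<Rightarrow> bool" where
  "left_ideal I R \<longleftrightarrow> additive_subgroup I R \<and> (\<forall>r\<in>carrier R. \<forall>a\<in>I. r \<otimes>\<^bsub>R\<^esub> a \<in> I)"

definition right_ideal :: "'a set \<Rightarrow> ('a, 'b) ring_scheme \<Rightarrow> bool" where
  "right_ideal I R \<longleftrightarrow> additive_subgroup I R \<and> (\<forall>r\<in>carrier R. \<forall>a\<in>I. a \<otimes>\<^bsub>R\<^esub> r \<in> I)"

definition artinian_ring :: "('a, 'b) ring_scheme \<Rightarrow> bool" where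
  "artinian_ring R \<longleftrightarrow> ring R \<and>
     (\<forall>I :: nat \<Rightarrow> 'a set. (\<forall>n. left_ideal (I n) R \<and> I (Suc n) \<subseteq> I n) \<longrightarrow> (\<exists>N. \<forall>n\<ge>N. I n = I N)) \<and>
     (\<forall>I :: nat \<Rightarrow> 'a set. (\<forall>n. right_ideal (I n) R \<and> I (Suc n) \<subseteq> I n) \<longrightarrow> (\<exists>N. \<forall>n\<ge>N. I n = I N))"

section \<open>Linear functors and equivalences\<close>

record ('o, 'm, 'p, 'n) func =
  FOb :: "'o \<Rightarrow> 'p"
  FMor :: "'o \<Rightarrow> 'o \<Rightarrow> 'm \<Rightarrow> 'n"

locale linear_functor =
  fixes K :: "('k, 'x) ring_scheme"
    and C :: "('k, 'o, 'm, 'z) lcat_scheme" and D :: "('k, 'p, 'n, 'w) lcat_scheme"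
    and F :: "('o, 'm, 'p, 'n) func"
  assumes ob_closed: "X \<in> Ob C \<Longrightarrow> FOb F X \<in> Ob D"
    and mor_closed: "\<lbrakk>X \<in> Ob C; Y \<in> Ob C; f \<in> mor C X Y\<rbrakk>
      \<Longrightarrow> FMor F X Y f \<in> mor D (FOb F X) (FOb F Y)"
    and map_idt: "X \<in> Ob C \<Longrightarrow> FMor F X X (Idt C X) = Idt D (FOb F X)"
    and map_cmp: "\<lbrakk>X \<in> Ob C; Y \<in> Ob C; Z \<in> Ob C; f \<in> mor C X Y; g \<in> mor C Y Z\<rbrakk>
      \<Longrightarrow> FMor F X Z (Cmp C X Y Z g f)
        = Cmp D (FOb F X) (FOb F Y) (FOb F Z) (FMor F Y Z g) (FMor F X Y f)"
    and map_add: "\<lbrakk>X \<in> Ob C; Y \<in> Ob C; f \<in> mor C X Y; g \<in> mor C X Y\<rbrakk>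
      \<Longrightarrow> FMor F X Y (f \<oplus>\<^bsub>Hom C X Y\<^esub> g)
        = FMor F X Y f \<oplus>\<^bsub>Hom D (FOb F X) (FOb F Y)\<^esub> FMor F X Y g"
    and map_smult: "\<lbrakk>X \<in> Ob C; Y \<in> Ob C; f \<in> mor C X Y; c \<in> carrier K\<rbrakk>
      \<Longrightarrow> FMor F X Y (c \<odot>\<^bsub>Hom C X Y\<^esub> f) = c \<odot>\<^bsub>Hom D (FOb F X) (FOb F Y)\<^esub> FMor F X Y f"

locale linear_equivalence = linear_functor +
  assumes fully_faithful: "\<lbrakk>X \<in> Ob C; Y \<in> Ob C\<rbrakk>
      \<Longrightarrow> bij_betw (FMor F X Y) (mor C X Y) (mor D (FOb F X) (FOb F Y))"
    and essentially_surjective: "W \<in> Ob D \<Longrightarrow> \<exists>X\<in>Ob C. isomorphic D (FOb F X) W"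

section \<open>Triangulated categories\<close>

text \<open>
  A sextuple \<open>(X, Y, Z, f, g, h)\<close> stands for \<open>X \<rightarrow> Y \<rightarrow> Z \<rightarrow> X[1]\<close>. The shift is required to be an
  autoequivalence and need not be bijective on objects.
\<close>

record ('k, 'o, 'm) scat = "('k, 'o, 'm) lcat" +
  Shift :: "('o, 'm, 'o, 'm) func"

type_synonym ('o, 'm) triangle = "'o \<times> 'o \<times> 'o \<times> 'm \<times> 'm \<times> 'm"

record ('k, 'o, 'm) tcat = "('k, 'o, 'm) scat" +
  Tri :: "('o, 'm) triangle set"

abbreviation sh :: "('k, 'o, 'm, 'z) scat_scheme \<Rightarrow> 'o \<Rightarrow> 'o"
  where "sh C X \<equiv> FOb (Shift C) X"

abbreviation shm :: "('k, 'o, 'm, 'z) scat_scheme \<Rightarrow> 'o \<Rightarrow> 'o \<Rightarrow> 'm \<Rightarrow> 'm"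
  where "shm C X Y f \<equiv> FMor (Shift C) X Y f"

fun candidate_triangle :: "('k, 'o, 'm, 'z) scat_scheme \<Rightarrow> ('o, 'm) triangle \<Rightarrow> bool" where
  "candidate_triangle C (X, Y, Z, f, g, h) \<longleftrightarrow>
     X \<in> Ob C \<and> Y \<in> Ob C \<and> Z \<in> Ob C \<and> f \<in> mor C X Y \<and> g \<in> mor C Y Z \<and> h \<in> mor C Z (sh C X)"

fun triangle_morphism ::
  "('k, 'o, 'm, 'z) scat_scheme \<Rightarrow> ('o, 'm) triangle \<Rightarrow> ('o, 'm) triangle \<Rightarrow> 'm \<Rightarrow> 'm \<Rightarrow> 'm \<Rightarrow> bool" where
  "triangle_morphism C (X, Y, Z, f, g, h) (X', Y', Z', f', g', h') a b c \<longleftrightarrow>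
     a \<in> mor C X X' \<and> b \<in> mor C Y Y' \<and> c \<in> mor C Z Z' \<and>
     Cmp C X Y Y' b f = Cmp C X X' Y' f' a \<and>
     Cmp C Y Z Z' c g = Cmp C Y Y' Z' g' b \<and>
     Cmp C Z (sh C X) (sh C X') (shm C X X' a) h = Cmp C Z Z' (sh C X') h' c"

fun triangle_isomorphic ::
  "('k, 'o, 'm, 'z) scat_scheme \<Rightarrow> ('o, 'm) triangle \<Rightarrow> ('o, 'm) triangle \<Rightarrow> bool" where
  "triangle_isomorphic C (X, Y, Z, f, g, h) (X', Y', Z', f', g', h') \<longleftrightarrow>
     (\<exists>a b c. is_iso C X X' a \<and> is_iso C Y Y' b \<and> is_iso C Z Z' c \<and>
        triangle_morphism C (X, Y, Z, f, g, h) (X', Y', Z', f', g', h') a b c)"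

locale triangulated_category = additive_category K C
  for K :: "('k, 'x) ring_scheme" and C :: "('k, 'o, 'm, 'z) tcat_scheme" +
  assumes shift_equivalence: "linear_equivalence K C C (Shift C)"
    and tri_candidate: "t \<in> Tri C \<Longrightarrow> candidate_triangle C t"
    and TR1_iso: "\<lbrakk>t \<in> Tri C; candidate_triangle C t'; triangle_isomorphic C t t'\<rbrakk> \<Longrightarrow> t' \<in> Tri C"
    and TR1_idt: "\<lbrakk>X \<in> Ob C; is_zero_object C Z\<rbrakk>
      \<Longrightarrow> (X, X, Z, Idt C X, zero_mor C X Z, zero_mor C Z (sh C X)) \<in> Tri C"
    and TR1_cone: "\<lbrakk>X \<in> Ob C; Y \<in> Ob C; f \<in> mor C X Y\<rbrakk> \<Longrightarrow> \<exists>Z g h. (X, Y, Z, f, g, h) \<in> Tri C"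
    and TR2: "candidate_triangle C (X, Y, Z, f, g, h) \<Longrightarrow>
      (X, Y, Z, f, g, h) \<in> Tri C \<longleftrightarrow>
      (Y, Z, sh C X, g, h, \<ominus>\<^bsub>Hom C (sh C X) (sh C Y)\<^esub> (shm C X Y f)) \<in> Tri C"
    and TR3: "\<lbrakk>(X, Y, Z, f, g, h) \<in> Tri C; (X', Y', Z', f', g', h') \<in> Tri C;
        a \<in> mor C X X'; b \<in> mor C Y Y'; Cmp C X Y Y' b f = Cmp C X X' Y' f' a\<rbrakk>
      \<Longrightarrow> \<exists>c. triangle_morphism C (X, Y, Z, f, g, h) (X', Y', Z', f', g', h') a b c"
    and TR4: "\<lbrakk>(X, Y, Z', f, j, k) \<in> Tri C; (Y, Z, X', g, l, i) \<in> Tri C;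
        (X, Z, Y', Cmp C X Y Z g f, m, n) \<in> Tri C\<rbrakk>
      \<Longrightarrow> \<exists>u v. (Z', Y', X', u, v, Cmp C X' (sh C Y) (sh C Z') (shm C Y Z' j) i) \<in> Tri C \<and>
            Cmp C Y Z' Y' u j = Cmp C Y Z Y' m g \<and>
            Cmp C Z' Y' (sh C X) n u = k \<and>
            Cmp C Z Y' X' v m = l \<and>
            Cmp C Y' X' (sh C Y) i v = Cmp C Y' (sh C X) (sh C Y) (shm C X Y f) n"

definition triangle_equivalence ::
  "('k, 'x) ring_scheme \<Rightarrow> ('k, 'o, 'm, 'z) tcat_scheme \<Rightarrow> ('k, 'p, 'n, 'w) tcat_scheme
    \<Rightarrow> ('o, 'm, 'p, 'n) func \<Rightarrow> ('o \<Rightarrow> 'n) \<Rightarrow> bool" where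
  "triangle_equivalence K C D F \<phi> \<longleftrightarrow> linear_equivalence K C D F \<and>
     (\<forall>X\<in>Ob C. is_iso D (FOb F (sh C X)) (sh D (FOb F X)) (\<phi> X)) \<and>
     (\<forall>X\<in>Ob C. \<forall>Y\<in>Ob C. \<forall>f\<in>mor C X Y.
        Cmp D (FOb F (sh C X)) (sh D (FOb F X)) (sh D (FOb F Y))
          (shm D (FOb F X) (FOb F Y) (FMor F X Y f)) (\<phi> X) =
        Cmp D (FOb F (sh C X)) (FOb F (sh C Y)) (sh D (FOb F Y))
          (\<phi> Y) (FMor F (sh C X) (sh C Y) (shm C X Y f))) \<and>
     (\<forall>X Y Z f g h. (X, Y, Z, f, g, h) \<in> Tri C \<longrightarrow>
        (FOb F X, FOb F Y, FOb F Z, FMor F X Y f, FMor F Y Z g,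
         Cmp D (FOb F Z) (FOb F (sh C X)) (sh D (FOb F X)) (\<phi> X) (FMor F Z (sh C X) h)) \<in> Tri D)"

definition triangle_equivalent ::
  "('k, 'x) ring_scheme \<Rightarrow> ('k, 'o, 'm, 'z) tcat_scheme \<Rightarrow> ('k, 'p, 'n, 'w) tcat_scheme \<Rightarrow> bool" where
  "triangle_equivalent K C D \<longleftrightarrow> (\<exists>F \<phi>. triangle_equivalence K C D F \<phi>)"

section \<open>Frobenius exact categories\<close>

text \<open>\<open>Conf\<close> is the class of conflations; \<open>(X, Y, Z, i, p)\<close> stands for \<open>X \<rightarrow> Y \<rightarrow> Z\<close>.\<close>

record ('k, 'o, 'm) ecat = "('k, 'o, 'm) lcat" +
  Conf :: "('o \<times> 'o \<times> 'o \<times> 'm \<times> 'm) set"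

definition is_kernel :: "('k, 'o, 'm, 'z) lcat_scheme \<Rightarrow> 'o \<Rightarrow> 'o \<Rightarrow> 'o \<Rightarrow> 'm \<Rightarrow> 'm \<Rightarrow> bool" where
  "is_kernel C X Y Z i p \<longleftrightarrow> i \<in> mor C X Y \<and> p \<in> mor C Y Z \<and> Cmp C X Y Z p i = zero_mor C X Z \<and>
     (\<forall>W\<in>Ob C. \<forall>f\<in>mor C W Y. Cmp C W Y Z p f = zero_mor C W Z \<longrightarrow>
        (\<exists>!h. h \<in> mor C W X \<and> Cmp C W X Y i h = f))"

definition is_cokernel :: "('k, 'o, 'm, 'z) lcat_scheme \<Rightarrow> 'o \<Rightarrow> 'o \<Rightarrow> 'o \<Rightarrow> 'm \<Rightarrow> 'm \<Rightarrow> bool" where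
  "is_cokernel C X Y Z i p \<longleftrightarrow> i \<in> mor C X Y \<and> p \<in> mor C Y Z \<and> Cmp C X Y Z p i = zero_mor C X Z \<and>
     (\<forall>W\<in>Ob C. \<forall>f\<in>mor C Y W. Cmp C X Y W f i = zero_mor C X W \<longrightarrow>
        (\<exists>!h. h \<in> mor C Z W \<and> Cmp C Y Z W h p = f))"

text \<open>The square with sides \<open>i : A \<rightarrow> B\<close>, \<open>f : A \<rightarrow> A'\<close>, \<open>i' : A' \<rightarrow> B'\<close>, \<open>f' : B \<rightarrow> B'\<close>.\<close>

definition is_pushout ::
  "('k, 'o, 'm, 'z) lcat_scheme \<Rightarrow> 'o \<Rightarrow> 'o \<Rightarrow> 'o \<Rightarrow> 'o \<Rightarrow> 'm \<Rightarrow> 'm \<Rightarrow> 'm \<Rightarrow> 'm \<Rightarrow> bool" where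
  "is_pushout C A B A' B' i f i' f' \<longleftrightarrow> B' \<in> Ob C \<and>
     i \<in> mor C A B \<and> f \<in> mor C A A' \<and> i' \<in> mor C A' B' \<and> f' \<in> mor C B B' \<and>
     Cmp C A B B' f' i = Cmp C A A' B' i' f \<and>
     (\<forall>W\<in>Ob C. \<forall>b\<in>mor C B W. \<forall>a\<in>mor C A' W. Cmp C A B W b i = Cmp C A A' W a f \<longrightarrow>
        (\<exists>!h. h \<in> mor C B' W \<and> Cmp C B B' W h f' = b \<and> Cmp C A' B' W h i' = a))"

text \<open>The square with sides \<open>p' : B' \<rightarrow> A'\<close>, \<open>f' : B' \<rightarrow> B\<close>, \<open>p : B \<rightarrow> A\<close>, \<open>f : A' \<rightarrow> A\<close>.\<close>

definition is_pullback ::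
  "('k, 'o, 'm, 'z) lcat_scheme \<Rightarrow> 'o \<Rightarrow> 'o \<Rightarrow> 'o \<Rightarrow> 'o \<Rightarrow> 'm \<Rightarrow> 'm \<Rightarrow> 'm \<Rightarrow> 'm \<Rightarrow> bool" where
  "is_pullback C B' A' B A p' f' p f \<longleftrightarrow> B' \<in> Ob C \<and>
     p' \<in> mor C B' A' \<and> f' \<in> mor C B' B \<and> p \<in> mor C B A \<and> f \<in> mor C A' A \<and>
     Cmp C B' B A p f' = Cmp C B' A' A f p' \<and>
     (\<forall>W\<in>Ob C. \<forall>b\<in>mor C W B. \<forall>a\<in>mor C W A'. Cmp C W B A p b = Cmp C W A' A f a \<longrightarrow>
        (\<exists>!h. h \<in> mor C W B' \<and> Cmp C W B' B f' h = b \<and> Cmp C W B' A' p' h = a))"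

definition inflation :: "('k, 'o, 'm, 'z) ecat_scheme \<Rightarrow> 'o \<Rightarrow> 'o \<Rightarrow> 'm \<Rightarrow> bool" where
  "inflation E X Y i \<longleftrightarrow> (\<exists>Z p. (X, Y, Z, i, p) \<in> Conf E)"

definition deflation :: "('k, 'o, 'm, 'z) ecat_scheme \<Rightarrow> 'o \<Rightarrow> 'o \<Rightarrow> 'm \<Rightarrow> bool" where
  "deflation E Y Z p \<longleftrightarrow> (\<exists>X i. (X, Y, Z, i, p) \<in> Conf E)"

locale exact_category = additive_category K E
  for K :: "('k, 'x) ring_scheme" and E :: "('k, 'o, 'm, 'z) ecat_scheme" +
  assumes conf_ob: "(X, Y, Z, i, p) \<in> Conf E \<Longrightarrow> X \<in> Ob E \<and> Y \<in> Ob E \<and> Z \<in> Ob E"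
    and conf_kernel: "(X, Y, Z, i, p) \<in> Conf E \<Longrightarrow> is_kernel E X Y Z i p"
    and conf_cokernel: "(X, Y, Z, i, p) \<in> Conf E \<Longrightarrow> is_cokernel E X Y Z i p"
    and conf_iso: "\<lbrakk>(X, Y, Z, i, p) \<in> Conf E; X' \<in> Ob E; Y' \<in> Ob E; Z' \<in> Ob E;
        is_iso E X X' a; is_iso E Y Y' b; is_iso E Z Z' c; i' \<in> mor E X' Y'; p' \<in> mor E Y' Z';
        Cmp E X X' Y' i' a = Cmp E X Y Y' b i; Cmp E Y Y' Z' p' b = Cmp E Y Z Z' c p\<rbrakk>
      \<Longrightarrow> (X', Y', Z', i', p') \<in> Conf E"
    and inflation_idt: "X \<in> Ob E \<Longrightarrow> inflation E X X (Idt E X)"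
    and deflation_idt: "X \<in> Ob E \<Longrightarrow> deflation E X X (Idt E X)"
    and inflation_cmp: "\<lbrakk>inflation E X Y i; inflation E Y Z j\<rbrakk> \<Longrightarrow> inflation E X Z (Cmp E X Y Z j i)"
    and deflation_cmp: "\<lbrakk>deflation E X Y p; deflation E Y Z q\<rbrakk> \<Longrightarrow> deflation E X Z (Cmp E X Y Z q p)"
    and inflation_pushout: "\<lbrakk>inflation E A B i; A' \<in> Ob E; f \<in> mor E A A'\<rbrakk>
      \<Longrightarrow> \<exists>B' i' f'. is_pushout E A B A' B' i f i' f' \<and> inflation E A' B' i'"
    and deflation_pullback: "\<lbrakk>deflation E B A p; A' \<in> Ob E; f \<in> mor E A' A\<rbrakk>
      \<Longrightarrow> \<exists>B' p' f'. is_pullback E B' A' B A p' f' p f \<and> deflation E B' A' p'"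

definition projective :: "('k, 'o, 'm, 'z) ecat_scheme \<Rightarrow> 'o \<Rightarrow> bool" where
  "projective E P \<longleftrightarrow> P \<in> Ob E \<and>
     (\<forall>Y Z p. deflation E Y Z p \<longrightarrow> (\<forall>f\<in>mor E P Z. \<exists>g\<in>mor E P Y. Cmp E P Y Z p g = f))"

definition injective :: "('k, 'o, 'm, 'z) ecat_scheme \<Rightarrow> 'o \<Rightarrow> bool" where
  "injective E I \<longleftrightarrow> I \<in> Ob E \<and>
     (\<forall>X Y i. inflation E X Y i \<longrightarrow> (\<forall>f\<in>mor E X I. \<exists>g\<in>mor E Y I. Cmp E X Y I g i = f))"

locale frobenius_category = exact_category +
  assumes enough_projectives: "X \<in> Ob E \<Longrightarrow> \<exists>P p. projective E P \<and> deflation E P X p"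
    and enough_injectives: "X \<in> Ob E \<Longrightarrow> \<exists>I i. injective E I \<and> inflation E X I i"
    and projective_iff_injective: "projective E P \<longleftrightarrow> injective E P"

section \<open>The stable category\<close>

definition stably_null :: "('k, 'o, 'm, 'z) ecat_scheme \<Rightarrow> 'o \<Rightarrow> 'o \<Rightarrow> 'm set" where
  "stably_null E X Y = {Cmp E X P Y b a | P a b. projective E P \<and> a \<in> mor E X P \<and> b \<in> mor E P Y}"

definition stable_class :: "('k, 'o, 'm, 'z) ecat_scheme \<Rightarrow> 'o \<Rightarrow> 'o \<Rightarrow> 'm \<Rightarrow> 'm set" where
  "stable_class E X Y f = stably_null E X Y +>\<^bsub>Hom E X Y\<^esub> f"

definition stable_Hom :: "('k, 'o, 'm, 'z) ecat_scheme \<Rightarrow> 'o \<Rightarrow> 'o \<Rightarrow> ('k, 'm set) module" where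
  "stable_Hom E X Y = \<lparr>carrier = a_rcosets\<^bsub>Hom E X Y\<^esub> (stably_null E X Y),
     mult = undefined, one = undefined,
     zero = stably_null E X Y, add = set_add (Hom E X Y),
     smult = (\<lambda>c A. \<Union>a\<in>A. stable_class E X Y (c \<odot>\<^bsub>Hom E X Y\<^esub> a))\<rparr>"

text \<open>
  A choice, for every object \<open>X\<close>, of a conflation \<open>X \<rightarrow> Inj X \<rightarrow> Susp X\<close> with \<open>Inj X\<close> injective. The
  stable category depends on this choice only up to triangle equivalence.
\<close>

record ('o, 'm) inj_choice =
  Inj :: "'o \<Rightarrow> 'o"
  Susp :: "'o \<Rightarrow> 'o"
  inc :: "'o \<Rightarrow> 'm"
  prj :: "'o \<Rightarrow> 'm"

definition injective_choice :: "('k, 'o, 'm, 'z) ecat_scheme \<Rightarrow> ('o, 'm) inj_choice \<Rightarrow> bool" where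
  "injective_choice E R \<longleftrightarrow>
     (\<forall>X\<in>Ob E. injective E (Inj R X) \<and> (X, Inj R X, Susp R X, inc R X, prj R X) \<in> Conf E)"

text \<open>
  The stable shift of the class of \<open>f : X \<rightarrow> Y\<close> is the class of any \<open>g\<close> completing \<open>f\<close> and some
  \<open>e : Inj X \<rightarrow> Inj Y\<close> to a morphism of the chosen conflations; the union below is over equal
  cosets.
\<close>

definition stable_shift_mor ::
  "('k, 'o, 'm, 'z) ecat_scheme \<Rightarrow> ('o, 'm) inj_choice \<Rightarrow> 'o \<Rightarrow> 'o \<Rightarrow> 'm set \<Rightarrow> 'm set" where
  "stable_shift_mor E R X Y A = \<Union> {stable_class E (Susp R X) (Susp R Y) g | g.
     g \<in> mor E (Susp R X) (Susp R Y) \<and>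
     (\<exists>f\<in>A. \<exists>e\<in>mor E (Inj R X) (Inj R Y).
        Cmp E X (Inj R X) (Inj R Y) e (inc R X) = Cmp E X Y (Inj R Y) (inc R Y) f \<and>
        Cmp E (Inj R X) (Susp R X) (Susp R Y) g (prj R X) =
        Cmp E (Inj R X) (Inj R Y) (Susp R Y) (prj R Y) e)}"

definition stable_shift_category ::
  "('k, 'o, 'm, 'z) ecat_scheme \<Rightarrow> ('o, 'm) inj_choice \<Rightarrow> ('k, 'o, 'm set) scat" where
  "stable_shift_category E R = \<lparr>Ob = Ob E, Hom = stable_Hom E,
     Cmp = (\<lambda>X Y Z B A. \<Union>b\<in>B. \<Union>a\<in>A. stable_class E X Z (Cmp E X Y Z b a)),
     Idt = (\<lambda>X. stable_class E X X (Idt E X)),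
     Shift = \<lparr>FOb = Susp R, FMor = stable_shift_mor E R\<rparr>\<rparr>"

text \<open>
  The standard triangle of \<open>u : X \<rightarrow> Y\<close>: \<open>Q\<close> is the pushout of \<open>u\<close> along \<open>X \<rightarrow> Inj X\<close>, and \<open>w\<close> is
  zero on \<open>Y\<close> and restricts to the projection \<open>Inj X \<rightarrow> Susp X\<close>.
\<close>

definition standard_triangles ::
  "('k, 'o, 'm, 'z) ecat_scheme \<Rightarrow> ('o, 'm) inj_choice \<Rightarrow> ('o, 'm set) triangle set" where
  "standard_triangles E R =
     {(X, Y, Q, stable_class E X Y u, stable_class E Y Q v, stable_class E Q (Susp R X) w)
       | X Y Q u v w. X \<in> Ob E \<and> Y \<in> Ob E \<and> w \<in> mor E Q (Susp R X) \<and>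
         (\<exists>u'. is_pushout E X (Inj R X) Y Q (inc R X) u v u' \<and>
            Cmp E (Inj R X) Q (Susp R X) w u' = prj R X) \<and>
         Cmp E Y Q (Susp R X) w v = zero_mor E Y (Susp R X)}"

definition stable_category ::
  "('k, 'o, 'm, 'z) ecat_scheme \<Rightarrow> ('o, 'm) inj_choice \<Rightarrow> ('k, 'o, 'm set) tcat" where
  "stable_category E R = scat.extend (stable_shift_category E R)
     \<lparr>Tri = {t. candidate_triangle (stable_shift_category E R) t \<and>
       (\<exists>s\<in>standard_triangles E R. triangle_isomorphic (stable_shift_category E R) s t)}\<rparr>"

section \<open>Smallness, coproducts and compact objects\<close>

text \<open>
  The distinction between sets and classes is made by a Grothendieck universe, represented by an
  uncountable strongly inaccessible cardinal \<open>\<kappa>\<close>: the sets are the collections of cardinality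
  less than \<open>\<kappa>\<close>. Every such set is in bijection with a subset of the type carrying \<open>\<kappa>\<close>, so
  set-indexed families may be indexed by subsets of that type.
\<close>

definition universe_cardinal :: "'u rel \<Rightarrow> bool" where
  "universe_cardinal \<kappa> \<longleftrightarrow> Card_order \<kappa> \<and> |UNIV :: nat set| <o \<kappa> \<and> regularCard \<kappa> \<and>
     (\<forall>A :: 'u set. |A| <o \<kappa> \<longrightarrow> |Pow A| <o \<kappa>)"

definition locally_small :: "'u rel \<Rightarrow> ('k, 'o, 'm, 'z) lcat_scheme \<Rightarrow> bool" where
  "locally_small \<kappa> C \<longleftrightarrow> (\<forall>X\<in>Ob C. \<forall>Y\<in>Ob C. |mor C X Y| <o \<kappa>)"

definition is_coproduct ::
  "('k, 'o, 'm, 'z) lcat_scheme \<Rightarrow> 'i set \<Rightarrow> ('i \<Rightarrow> 'o) \<Rightarrow> 'o \<Rightarrow> ('i \<Rightarrow> 'm) \<Rightarrow> bool" where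
  "is_coproduct C I X P \<iota> \<longleftrightarrow> P \<in> Ob C \<and> (\<forall>i\<in>I. \<iota> i \<in> mor C (X i) P) \<and>
     (\<forall>Y\<in>Ob C. \<forall>f. (\<forall>i\<in>I. f i \<in> mor C (X i) Y) \<longrightarrow>
        (\<exists>!h. h \<in> mor C P Y \<and> (\<forall>i\<in>I. Cmp C (X i) P Y h (\<iota> i) = f i)))"

definition has_coproducts :: "'u rel \<Rightarrow> ('k, 'o, 'm, 'z) lcat_scheme \<Rightarrow> bool" where
  "has_coproducts \<kappa> C \<longleftrightarrow>
     (\<forall>(I :: 'u set) X. |I| <o \<kappa> \<and> (\<forall>i\<in>I. X i \<in> Ob C) \<longrightarrow> (\<exists>P \<iota>. is_coproduct C I X P \<iota>))"

text \<open>
  The coproduct of the modules \<open>Hom(C, X i)\<close>, as finitely supported families, and the canonical map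
  from it to \<open>Hom(C, P)\<close> induced by \<open>\<iota> i : X i \<rightarrow> P\<close>.
\<close>

definition hom_support ::
  "('k, 'o, 'm, 'z) lcat_scheme \<Rightarrow> 'o \<Rightarrow> 'i set \<Rightarrow> ('i \<Rightarrow> 'o) \<Rightarrow> ('i \<Rightarrow> 'm) \<Rightarrow> 'i set" where
  "hom_support S C I X g = {i \<in> I. g i \<noteq> zero_mor S C (X i)}"

definition hom_sum ::
  "('k, 'o, 'm, 'z) lcat_scheme \<Rightarrow> 'o \<Rightarrow> 'i set \<Rightarrow> ('i \<Rightarrow> 'o) \<Rightarrow> ('i \<Rightarrow> 'm) set" where
  "hom_sum S C I X = {g \<in> (\<Pi>\<^sub>E i\<in>I. mor S C (X i)). finite (hom_support S C I X g)}"

definition hom_sum_map ::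
  "('k, 'o, 'm, 'z) lcat_scheme \<Rightarrow> 'o \<Rightarrow> 'i set \<Rightarrow> ('i \<Rightarrow> 'o) \<Rightarrow> 'o \<Rightarrow> ('i \<Rightarrow> 'm) \<Rightarrow> ('i \<Rightarrow> 'm) \<Rightarrow> 'm" where
  "hom_sum_map S C I X P \<iota> g =
     (\<Oplus>\<^bsub>Hom S C P\<^esub> i\<in>hom_support S C I X g. Cmp S C (X i) P (\<iota> i) (g i))"

definition compact_object :: "'u rel \<Rightarrow> ('k, 'o, 'm, 'z) lcat_scheme \<Rightarrow> 'o \<Rightarrow> bool" where
  "compact_object \<kappa> S C \<longleftrightarrow> C \<in> Ob S \<and>
     (\<forall>(I :: 'u set) X P \<iota>. |I| <o \<kappa> \<and> (\<forall>i\<in>I. X i \<in> Ob S) \<and> is_coproduct S I X P \<iota> \<longrightarrow>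
        bij_betw (hom_sum_map S C I X P \<iota>) (hom_sum S C I X) (mor S C P))"

definition compact_category :: "'u rel \<Rightarrow> ('k, 'o, 'm) tcat \<Rightarrow> ('k, 'o, 'm) tcat" where
  "compact_category \<kappa> S = S\<lparr>Ob := {C. compact_object \<kappa> S C},
     Tri := {(X, Y, Z, f, g, h) \<in> Tri S.
       compact_object \<kappa> S X \<and> compact_object \<kappa> S Y \<and> compact_object \<kappa> S Z}\<rparr>"

text \<open>
  \<open>D\<close> is (isomorphic to) \<open>C[n]\<close>. As the shift is only an autoequivalence, \<open>C[n]\<close> for negative \<open>n\<close>
  is determined up to isomorphism by \<open>C[n][-n] \<cong> C\<close>.
\<close>

definition is_shift :: "('k, 'o, 'm, 'z) scat_scheme \<Rightarrow> 'o \<Rightarrow> int \<Rightarrow> 'o \<Rightarrow> bool" where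
  "is_shift S C n D \<longleftrightarrow> D \<in> Ob S \<and>
     (if n \<ge> 0 then isomorphic S ((sh S ^^ nat n) C) D else isomorphic S ((sh S ^^ nat (- n)) D) C)"

definition compactly_generated :: "'u rel \<Rightarrow> ('k, 'o, 'm, 'z) scat_scheme \<Rightarrow> bool" where
  "compactly_generated \<kappa> S \<longleftrightarrow> has_coproducts \<kappa> S \<and>
     (\<exists>G. |G| <o \<kappa> \<and> (\<forall>C\<in>G. compact_object \<kappa> S C) \<and>
        (\<forall>X\<in>Ob S. (\<forall>C\<in>G. \<forall>n D. is_shift S C n D \<longrightarrow> mor S D X = {zero_mor S D X})
           \<longrightarrow> is_zero_object S X))"

text \<open>The last two arguments only fix the types over which the Frobenius category ranges.\<close>

definition algebraic ::
  "('k, 'x) ring_scheme \<Rightarrow> 'u rel \<Rightarrow> ('k, 'o, 'm) tcat \<Rightarrow> 'p itself \<Rightarrow> 'n itself \<Rightarrow> bool" where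
  "algebraic K \<kappa> S _ _ \<longleftrightarrow> (\<exists>(E :: ('k, 'p, 'n) ecat) R. frobenius_category K E \<and>
     locally_small \<kappa> E \<and> injective_choice E R \<and> triangle_equivalent K S (stable_category E R))"

end

theory Submission
  imports Defs
begin

text \<open>
  Given \<open>v\<close>, \<open>u\<close> as in (1), let \<open>\<phi>\<^sub>k : Z \<rightarrow> M\<^sup>k\<close> have components
  \<open>u, uv, \<dots>, uv\<^sup>k\<^sup>-\<^sup>1\<close>. Then \<open>(1 \<oplus> \<phi>\<^sub>k) (u, v) = \<phi>\<^sub>k\<^sub>+\<^sub>1\<close>, and if \<open>v\<^sup>k = 0\<close> the right-hand side is
  \<open>(\<phi>\<^sub>k, 0) : Z \<rightarrow> M\<^sup>k \<oplus> M\<close>. With \<open>W\<close> the cone of \<open>\<phi>\<^sub>k\<close>, the three maps have cones \<open>W\<close>, \<open>N\<close> and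
  \<open>W \<oplus> M\<close>, so the octahedral axiom gives a triangle \<open>N \<rightarrow> W \<oplus> M \<rightarrow> W \<rightarrow> N[1]\<close>. The component
  \<open>W \<rightarrow> W\<close> extends \<open>v\<close> and the nilpotent shift endomorphism of \<open>M\<^sup>k\<close> to an endomorphism of the
  triangle \<open>Z \<rightarrow> M\<^sup>k \<rightarrow> W \<rightarrow> Z[1]\<close>, and such an extension of nilpotent maps is nilpotent. The
  converse is dual, up to desuspending the cone.
\<close>

section \<open>Linear categories and biproducts\<close>

context linear_category
begin

lemma hom_abelian_group: "\<lbrakk>X \<in> Ob C; Y \<in> Ob C\<rbrakk> \<Longrightarrow> abelian_group (Hom C X Y)"
  using hom_module module.axioms(2) by blast

lemma zero_closed [simp]: "\<lbrakk>X \<in> Ob C; Y \<in> Ob C\<rbrakk> \<Longrightarrow> zero_mor C X Y \<in> mor C X Y"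
  by (rule abelian_monoid.zero_closed[OF abelian_group.axioms(1)[OF hom_abelian_group]])

lemma add_closed [simp]:
  "\<lbrakk>f \<in> mor C X Y; g \<in> mor C X Y; X \<in> Ob C; Y \<in> Ob C\<rbrakk> \<Longrightarrow> f \<oplus>\<^bsub>Hom C X Y\<^esub> g \<in> mor C X Y"
  by (rule abelian_monoid.a_closed[OF abelian_group.axioms(1)[OF hom_abelian_group]])

lemma neg_closed [simp]:
  "\<lbrakk>f \<in> mor C X Y; X \<in> Ob C; Y \<in> Ob C\<rbrakk> \<Longrightarrow> \<ominus>\<^bsub>Hom C X Y\<^esub> f \<in> mor C X Y"
  by (rule abelian_group.a_inv_closed[OF hom_abelian_group])

lemma add_zero [simp]:
  "\<lbrakk>f \<in> mor C X Y; X \<in> Ob C; Y \<in> Ob C\<rbrakk> \<Longrightarrow> f \<oplus>\<^bsub>Hom C X Y\<^esub> zero_mor C X Y = f"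
  "\<lbrakk>f \<in> mor C X Y; X \<in> Ob C; Y \<in> Ob C\<rbrakk> \<Longrightarrow> zero_mor C X Y \<oplus>\<^bsub>Hom C X Y\<^esub> f = f"
  by (rule abelian_monoid.r_zero[OF abelian_group.axioms(1)[OF hom_abelian_group]] abelian_monoid.l_zero[OF abelian_group.axioms(1)[OF hom_abelian_group]]; assumption)+

lemma neg_add [simp]:
  "\<lbrakk>f \<in> mor C X Y; X \<in> Ob C; Y \<in> Ob C\<rbrakk> \<Longrightarrow> \<ominus>\<^bsub>Hom C X Y\<^esub> f \<oplus>\<^bsub>Hom C X Y\<^esub> f = zero_mor C X Y"
  "\<lbrakk>f \<in> mor C X Y; X \<in> Ob C; Y \<in> Ob C\<rbrakk> \<Longrightarrow> f \<oplus>\<^bsub>Hom C X Y\<^esub> \<ominus>\<^bsub>Hom C X Y\<^esub> f = zero_mor C X Y"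
  by (rule abelian_group.l_neg[OF hom_abelian_group] abelian_group.r_neg[OF hom_abelian_group]; assumption)+

lemma add_assoc:
  "\<lbrakk>f \<in> mor C X Y; g \<in> mor C X Y; h \<in> mor C X Y; X \<in> Ob C; Y \<in> Ob C\<rbrakk>
    \<Longrightarrow> (f \<oplus>\<^bsub>Hom C X Y\<^esub> g) \<oplus>\<^bsub>Hom C X Y\<^esub> h = f \<oplus>\<^bsub>Hom C X Y\<^esub> (g \<oplus>\<^bsub>Hom C X Y\<^esub> h)"
  by (rule abelian_monoid.a_assoc[OF abelian_group.axioms(1)[OF hom_abelian_group]])

lemma add_comm:
  "\<lbrakk>f \<in> mor C X Y; g \<in> mor C X Y; X \<in> Ob C; Y \<in> Ob C\<rbrakk>
    \<Longrightarrow> f \<oplus>\<^bsub>Hom C X Y\<^esub> g = g \<oplus>\<^bsub>Hom C X Y\<^esub> f"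
  by (rule abelian_monoid.a_comm[OF abelian_group.axioms(1)[OF hom_abelian_group]])

lemma neg_add_cancel [simp]:
  "\<lbrakk>f \<in> mor C X Y; g \<in> mor C X Y; X \<in> Ob C; Y \<in> Ob C\<rbrakk>
    \<Longrightarrow> \<ominus>\<^bsub>Hom C X Y\<^esub> f \<oplus>\<^bsub>Hom C X Y\<^esub> (f \<oplus>\<^bsub>Hom C X Y\<^esub> g) = g"
  "\<lbrakk>f \<in> mor C X Y; g \<in> mor C X Y; X \<in> Ob C; Y \<in> Ob C\<rbrakk>
    \<Longrightarrow> f \<oplus>\<^bsub>Hom C X Y\<^esub> (\<ominus>\<^bsub>Hom C X Y\<^esub> f \<oplus>\<^bsub>Hom C X Y\<^esub> g) = g"
  by (simp_all flip: add_assoc)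

lemma neg_neg [simp]:
  "\<lbrakk>f \<in> mor C X Y; X \<in> Ob C; Y \<in> Ob C\<rbrakk> \<Longrightarrow> \<ominus>\<^bsub>Hom C X Y\<^esub> (\<ominus>\<^bsub>Hom C X Y\<^esub> f) = f"
  by (rule abelian_group.minus_minus[OF hom_abelian_group])

text \<open>This turns additivity into preservation of zero, for composition and later for the
  shift.\<close>

lemma zero_if_add_self:
  assumes "X \<in> Ob C" "Y \<in> Ob C" "f \<in> mor C X Y" "f \<oplus>\<^bsub>Hom C X Y\<^esub> f = f"
  shows "f = zero_mor C X Y"
  using assms add_assoc[of "\<ominus>\<^bsub>Hom C X Y\<^esub> f" X Y f f] by simp

lemma neg_unique:
  assumes "X \<in> Ob C" "Y \<in> Ob C" "f \<in> mor C X Y" "g \<in> mor C X Y"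
    and "f \<oplus>\<^bsub>Hom C X Y\<^esub> g = zero_mor C X Y"
  shows "g = \<ominus>\<^bsub>Hom C X Y\<^esub> f"
  using assms add_assoc[of "\<ominus>\<^bsub>Hom C X Y\<^esub> f" X Y f g] by simp

lemma neg_zero [simp]:
  "\<lbrakk>X \<in> Ob C; Y \<in> Ob C\<rbrakk> \<Longrightarrow> \<ominus>\<^bsub>Hom C X Y\<^esub> (zero_mor C X Y) = zero_mor C X Y"
  using neg_unique[of X Y "zero_mor C X Y" "zero_mor C X Y"] by simp

declare idt_closed [simp] cmp_closed [simp] idt_left [simp] idt_right [simp]

lemma cmp_zero_left [simp]:
  assumes "X \<in> Ob C" "Y \<in> Ob C" "Z \<in> Ob C" "f \<in> mor C X Y"
  shows "Cmp C X Y Z (zero_mor C Y Z) f = zero_mor C X Z"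
  using assms cmp_add_left[of X Y Z f "zero_mor C Y Z" "zero_mor C Y Z"]
  by (intro zero_if_add_self) auto

lemma cmp_zero_right [simp]:
  assumes "X \<in> Ob C" "Y \<in> Ob C" "Z \<in> Ob C" "g \<in> mor C Y Z"
  shows "Cmp C X Y Z g (zero_mor C X Y) = zero_mor C X Z"
  using assms cmp_add_right[of X Y Z "zero_mor C X Y" "zero_mor C X Y" g]
  by (intro zero_if_add_self) auto

lemma cmp_neg_left [simp]:
  assumes "X \<in> Ob C" "Y \<in> Ob C" "Z \<in> Ob C" "f \<in> mor C X Y" "g \<in> mor C Y Z"
  shows "Cmp C X Y Z (\<ominus>\<^bsub>Hom C Y Z\<^esub> g) f = \<ominus>\<^bsub>Hom C X Z\<^esub> (Cmp C X Y Z g f)"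
  using assms cmp_add_left[of X Y Z f g "\<ominus>\<^bsub>Hom C Y Z\<^esub> g"]
  by (intro neg_unique) auto

lemma cmp_neg_right [simp]:
  assumes "X \<in> Ob C" "Y \<in> Ob C" "Z \<in> Ob C" "f \<in> mor C X Y" "g \<in> mor C Y Z"
  shows "Cmp C X Y Z g (\<ominus>\<^bsub>Hom C X Y\<^esub> f) = \<ominus>\<^bsub>Hom C X Z\<^esub> (Cmp C X Y Z g f)"
  using assms cmp_add_right[of X Y Z f "\<ominus>\<^bsub>Hom C X Y\<^esub> f" g]
  by (intro neg_unique) auto

text \<open>As rewrite rules these expand a composite into a right-bracketed sum of right-bracketed
  composites, to which the biproduct relations then apply.\<close>

lemmas cmp_distrib = cmp_assoc cmp_add_left cmp_add_right add_assoc

text \<open>The last four facts are the biproduct relations in the shape in which they occur inside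
  right-bracketed composites, with a further morphism \<open>f\<close> on the right.\<close>

lemma biproductD:
  assumes "biproduct C X Y P i1 i2 p1 p2" "X \<in> Ob C" "Y \<in> Ob C"
  shows "P \<in> Ob C" "i1 \<in> mor C X P" "i2 \<in> mor C Y P" "p1 \<in> mor C P X" "p2 \<in> mor C P Y"
    "Cmp C X P X p1 i1 = Idt C X" "Cmp C Y P Y p2 i2 = Idt C Y"
    "Cmp C Y P X p1 i2 = zero_mor C Y X" "Cmp C X P Y p2 i1 = zero_mor C X Y"
    "\<And>W f. \<lbrakk>W \<in> Ob C; f \<in> mor C W X\<rbrakk> \<Longrightarrow> Cmp C W P X p1 (Cmp C W X P i1 f) = f"
    "\<And>W f. \<lbrakk>W \<in> Ob C; f \<in> mor C W Y\<rbrakk> \<Longrightarrow> Cmp C W P Y p2 (Cmp C W Y P i2 f) = f"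
    "\<And>W f. \<lbrakk>W \<in> Ob C; f \<in> mor C W Y\<rbrakk> \<Longrightarrow> Cmp C W P X p1 (Cmp C W Y P i2 f) = zero_mor C W X"
    "\<And>W f. \<lbrakk>W \<in> Ob C; f \<in> mor C W X\<rbrakk> \<Longrightarrow> Cmp C W P Y p2 (Cmp C W X P i1 f) = zero_mor C W Y"
proof -
  note b = assms(1)[unfolded biproduct_def] assms(2,3)
  from b show "P \<in> Ob C" "i1 \<in> mor C X P" "i2 \<in> mor C Y P" "p1 \<in> mor C P X" "p2 \<in> mor C P Y"
    "Cmp C X P X p1 i1 = Idt C X" "Cmp C Y P Y p2 i2 = Idt C Y"
    "Cmp C Y P X p1 i2 = zero_mor C Y X" "Cmp C X P Y p2 i1 = zero_mor C X Y" by auto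
  fix W f
  show "\<lbrakk>W \<in> Ob C; f \<in> mor C W X\<rbrakk> \<Longrightarrow> Cmp C W P X p1 (Cmp C W X P i1 f) = f"
    "\<lbrakk>W \<in> Ob C; f \<in> mor C W Y\<rbrakk> \<Longrightarrow> Cmp C W P Y p2 (Cmp C W Y P i2 f) = f"
    "\<lbrakk>W \<in> Ob C; f \<in> mor C W Y\<rbrakk> \<Longrightarrow> Cmp C W P X p1 (Cmp C W Y P i2 f) = zero_mor C W X"
    "\<lbrakk>W \<in> Ob C; f \<in> mor C W X\<rbrakk> \<Longrightarrow> Cmp C W P Y p2 (Cmp C W X P i1 f) = zero_mor C W Y"
    using b by (simp_all flip: cmp_assoc)
qed

text \<open>Resolving the identity of \<open>P\<close> recovers a morphism from its components; this
  is how an unknown map supplied by an axiom becomes a \<open>column\<close> or a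
  \<open>row\<close>.\<close>

lemma biproduct_decompose:
  assumes "biproduct C X Y P i1 i2 p1 p2" "X \<in> Ob C" "Y \<in> Ob C"
  shows "Cmp C P X P i1 p1 \<oplus>\<^bsub>Hom C P P\<^esub> Cmp C P Y P i2 p2 = Idt C P"
    and "\<lbrakk>W \<in> Ob C; f \<in> mor C W P\<rbrakk> \<Longrightarrow>
      Cmp C W X P i1 (Cmp C W P X p1 f) \<oplus>\<^bsub>Hom C W P\<^esub> Cmp C W Y P i2 (Cmp C W P Y p2 f) = f"
    and "\<lbrakk>W \<in> Ob C; f \<in> mor C P W\<rbrakk> \<Longrightarrow>
      Cmp C P X W (Cmp C X P W f i1) p1 \<oplus>\<^bsub>Hom C P W\<^esub> Cmp C P Y W (Cmp C Y P W f i2) p2 = f"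
proof -
  note b = biproductD[OF assms] assms(2,3)
  show i: "Cmp C P X P i1 p1 \<oplus>\<^bsub>Hom C P P\<^esub> Cmp C P Y P i2 p2 = Idt C P"
    using assms(1) by (simp add: biproduct_def)
  show "Cmp C W X P i1 (Cmp C W P X p1 f) \<oplus>\<^bsub>Hom C W P\<^esub> Cmp C W Y P i2 (Cmp C W P Y p2 f) = f"
    if "W \<in> Ob C" "f \<in> mor C W P"
    using b that i cmp_add_left[of W P P f "Cmp C P X P i1 p1" "Cmp C P Y P i2 p2"]
    by (simp add: cmp_assoc)
  show "Cmp C P X W (Cmp C X P W f i1) p1 \<oplus>\<^bsub>Hom C P W\<^esub> Cmp C P Y W (Cmp C Y P W f i2) p2 = f"
    if "W \<in> Ob C" "f \<in> mor C P W"
    using b that i cmp_add_right[of P P W "Cmp C P X P i1 p1" "Cmp C P Y P i2 p2" f]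
    by (simp add: cmp_assoc)
qed

lemma biproduct_swap:
  assumes "biproduct C X Y P i1 i2 p1 p2" "X \<in> Ob C" "Y \<in> Ob C"
  shows "biproduct C Y X P i2 i1 p2 p1"
proof -
  note b = biproductD[OF assms] assms(2,3)
  have "Cmp C P Y P i2 p2 \<oplus>\<^bsub>Hom C P P\<^esub> Cmp C P X P i1 p1 = Idt C P"
    using b biproduct_decompose(1)[OF assms] add_comm[of "Cmp C P Y P i2 p2" P P "Cmp C P X P i1 p1"]
    by simp
  with b show ?thesis by (simp add: biproduct_def)
qed

section \<open>Isomorphisms and powers of endomorphisms\<close>

lemma is_isoI:
  assumes "X \<in> Ob C" "Y \<in> Ob C" "f \<in> mor C X Y" "g \<in> mor C Y X" "g' \<in> mor C Y X"
    and "Cmp C X Y X g f = Idt C X" "Cmp C Y X Y f g' = Idt C Y"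
  shows "is_iso C X Y f"
proof -
  have "g = g'"
    using assms cmp_assoc[of Y X Y X g' f g] by simp
  with assms show ?thesis by (auto simp: is_iso_def)
qed

text \<open>The negative serves to change the signs of two maps of a triangle.\<close>

lemma is_iso_idt:
  assumes "X \<in> Ob C"
  shows "is_iso C X X (Idt C X)" "is_iso C X X (\<ominus>\<^bsub>Hom C X X\<^esub> (Idt C X))"
  using assms is_isoI[of X X "Idt C X" "Idt C X" "Idt C X"]
    is_isoI[of X X "\<ominus>\<^bsub>Hom C X X\<^esub> (Idt C X)" "\<ominus>\<^bsub>Hom C X X\<^esub> (Idt C X)" "\<ominus>\<^bsub>Hom C X X\<^esub> (Idt C X)"]
  by simp_all

lemma End_ring_simps [simp]:
  "carrier (End_ring C X) = mor C X X" "x \<otimes>\<^bsub>End_ring C X\<^esub> y = Cmp C X X X x y"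
  "\<one>\<^bsub>End_ring C X\<^esub> = Idt C X"
  by (simp_all add: End_ring_def)

lemma monoid_End_ring: "X \<in> Ob C \<Longrightarrow> monoid (End_ring C X)"
  by (rule monoidI) (simp_all add: cmp_assoc)

lemma pow_closed [simp]:
  "\<lbrakk>v \<in> mor C X X; X \<in> Ob C\<rbrakk> \<Longrightarrow> v [^]\<^bsub>End_ring C X\<^esub> (n::nat) \<in> mor C X X"
  using monoid.nat_pow_closed[OF monoid_End_ring] by simp

lemma pow_add:
  "\<lbrakk>v \<in> mor C X X; X \<in> Ob C\<rbrakk> \<Longrightarrow>
    v [^]\<^bsub>End_ring C X\<^esub> (m + n :: nat)
      = Cmp C X X X (v [^]\<^bsub>End_ring C X\<^esub> m) (v [^]\<^bsub>End_ring C X\<^esub> n)"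
  using monoid.nat_pow_mult[OF monoid_End_ring, of X v m n] by simp

text \<open>With \<open>s\<close> nilpotent, some power of \<open>w\<close> vanishes after
  \<open>a\<close>; with \<open>w\<close> nilpotent, \<open>a\<close> vanishes after some power of
  \<open>s\<close>.\<close>

lemma pow_intertwine:
  assumes "X \<in> Ob C" "Y \<in> Ob C" "a \<in> mor C X Y" "s \<in> mor C X X" "w \<in> mor C Y Y"
    and "Cmp C X Y Y w a = Cmp C X X Y a s"
  shows "Cmp C X Y Y (w [^]\<^bsub>End_ring C Y\<^esub> (n::nat)) a = Cmp C X X Y a (s [^]\<^bsub>End_ring C X\<^esub> n)"
proof (induction n)
  case 0
  with assms show ?case by simp
next
  case (Suc n)
  have "Cmp C X Y Y (w [^]\<^bsub>End_ring C Y\<^esub> (Suc n)) a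
      = Cmp C X Y Y (w [^]\<^bsub>End_ring C Y\<^esub> n) (Cmp C X X Y a s)"
    using assms by (simp add: cmp_assoc)
  also have "\<dots> = Cmp C X X Y (Cmp C X Y Y (w [^]\<^bsub>End_ring C Y\<^esub> n) a) s"
    using assms by (simp add: cmp_assoc)
  also have "\<dots> = Cmp C X X Y a (s [^]\<^bsub>End_ring C X\<^esub> (Suc n))"
    unfolding Suc using assms by (simp add: cmp_assoc)
  finally show ?case .
qed


text \<open>The inverse is the truncated geometric series \<open>2 - x\<close>.\<close>

lemma unipotent_inverse:
  assumes "X \<in> Ob C" "x \<in> mor C X X"
    and "e = x \<oplus>\<^bsub>Hom C X X\<^esub> \<ominus>\<^bsub>Hom C X X\<^esub> (Idt C X)"
    and "Cmp C X X X e e = zero_mor C X X"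
  obtains y where "y \<in> mor C X X" "Cmp C X X X y x = Idt C X" "Cmp C X X X x y = Idt C X"
proof
  let ?y = "\<ominus>\<^bsub>Hom C X X\<^esub> e \<oplus>\<^bsub>Hom C X X\<^esub> Idt C X"
  have e: "e \<in> mor C X X" using assms by simp
  have x: "x = e \<oplus>\<^bsub>Hom C X X\<^esub> Idt C X"
    using assms by (simp add: add_assoc)
  show "?y \<in> mor C X X" using assms(1) e by simp
  show "Cmp C X X X ?y x = Idt C X" "Cmp C X X X x ?y = Idt C X"
    unfolding x using assms(1,4) e
    by (simp_all add: cmp_distrib)
qed

text \<open>\<open>nat_pow_Suc\<close> puts the new factor on the right; the composites
  \<open>v^l u\<close> need it on the left.\<close>

lemma pow_Suc2:
  assumes "v \<in> mor C X X" "X \<in> Ob C"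
  shows "Cmp C X X X v (v [^]\<^bsub>End_ring C X\<^esub> (n::nat)) = v [^]\<^bsub>End_ring C X\<^esub> (Suc n)"
  using pow_add[OF assms, of 1 n] assms by simp

text \<open>Rebracketing \<open>(ab)(ab)...(ab)\<close>. Nilpotency thus passes from
  \<open>ba\<close> to \<open>ab\<close>, raising the exponent by one.\<close>

lemma pow_cycle:
  assumes "X \<in> Ob C" "Y \<in> Ob C" "a \<in> mor C X Y" "b \<in> mor C Y X"
  shows "(Cmp C Y X Y a b) [^]\<^bsub>End_ring C Y\<^esub> (Suc n)
    = Cmp C Y X Y (Cmp C X X Y a ((Cmp C X Y X b a) [^]\<^bsub>End_ring C X\<^esub> n)) b"
  using assms pow_intertwine[of X Y a "Cmp C X Y X b a" "Cmp C Y X Y a b" n, symmetric]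
  by (simp add: cmp_assoc)

end

section \<open>Iterated sums of one object and their shift endomorphisms\<close>

context additive_category
begin

text \<open>
  Here \<open>B\<close> is \<open>M\<^sup>k\<^sup>+\<^sup>1\<close>, and \<open>P\<close> is \<open>M\<^sup>k\<^sup>+\<^sup>2\<close> split off its first (\<open>i\<close>, \<open>p\<close>) and its last (\<open>j\<close>, \<open>q\<close>) summand;
  \<open>\<phi>\<close> and \<open>\<psi>\<close> have the components \<open>u v\<^sup>l\<close> and \<open>v\<^sup>l u\<close>.
\<close>

lemma biproduct_tower:
  assumes M: "M \<in> Ob C"
  shows "\<exists>B P i1 i2 p1 p2 j1 j2 q1 q2. B \<in> Ob C \<and>
    biproduct C M B P i1 i2 p1 p2 \<and> biproduct C B M P j1 j2 q1 q2 \<and>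
    (Cmp C B P B p2 j1) [^]\<^bsub>End_ring C B\<^esub> (Suc k) = zero_mor C B B \<and> (Cmp C B P B q1 i2) [^]\<^bsub>End_ring C B\<^esub> (Suc k) = zero_mor C B B \<and>
    (\<forall>Z\<in>Ob C. \<forall>u\<in>mor C Z M. \<forall>v\<in>mor C Z Z. \<exists>\<phi>\<in>mor C Z B.
      Cmp C Z M P i1 u \<oplus>\<^bsub>Hom C Z P\<^esub> Cmp C Z B P i2 (Cmp C Z Z B \<phi> v)
      = Cmp C Z B P j1 \<phi> \<oplus>\<^bsub>Hom C Z P\<^esub> Cmp C Z M P j2 (Cmp C Z Z M u (v [^]\<^bsub>End_ring C Z\<^esub> (Suc k)))) \<and>
    (\<forall>Z\<in>Ob C. \<forall>u\<in>mor C M Z. \<forall>v\<in>mor C Z Z. \<exists>\<psi>\<in>mor C B Z.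
      Cmp C P M Z u p1 \<oplus>\<^bsub>Hom C P Z\<^esub> Cmp C P B Z (Cmp C B Z Z v \<psi>) p2
      = Cmp C P B Z \<psi> q1 \<oplus>\<^bsub>Hom C P Z\<^esub> Cmp C P M Z (Cmp C M Z Z (v [^]\<^bsub>End_ring C Z\<^esub> (Suc k)) u) q2)"
proof (induction k)
  case 0
  obtain P i1 i2 p1 p2 where b: "biproduct C M M P i1 i2 p1 p2"
    using biproducts M by blast
  note d = biproductD[OF b M M] M
  show ?case
    \<comment> \<open>Both splittings of \<open>M \<oplus> M\<close> are taken equal, so
      \<open>p2 j1\<close> and \<open>q1 i2\<close> are zero, and \<open>u\<close> itself serves as
      \<open>\<phi>\<close> and as \<open>\<psi>\<close>.\<close>
    apply (rule exI[of _ M], rule exI[of _ P], rule exI[of _ i1], rule exI[of _ i2], rule exI[of _ p1],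
        rule exI[of _ p2], rule exI[of _ i1], rule exI[of _ i2], rule exI[of _ p1], rule exI[of _ p2])
    using b d by (auto intro!: bexI)
next
  case (Suc k)
  then obtain B P i1 i2 p1 p2 j1 j2 q1 q2 where B: "B \<in> Ob C"
    and bi: "biproduct C M B P i1 i2 p1 p2" and bj: "biproduct C B M P j1 j2 q1 q2"
    and s: "(Cmp C B P B p2 j1) [^]\<^bsub>End_ring C B\<^esub> (Suc k) = zero_mor C B B"
    and r: "(Cmp C B P B q1 i2) [^]\<^bsub>End_ring C B\<^esub> (Suc k) = zero_mor C B B"
    and \<phi>: "\<forall>Z\<in>Ob C. \<forall>u\<in>mor C Z M. \<forall>v\<in>mor C Z Z. \<exists>\<phi>\<in>mor C Z B.
      Cmp C Z M P i1 u \<oplus>\<^bsub>Hom C Z P\<^esub> Cmp C Z B P i2 (Cmp C Z Z B \<phi> v)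
      = Cmp C Z B P j1 \<phi> \<oplus>\<^bsub>Hom C Z P\<^esub> Cmp C Z M P j2 (Cmp C Z Z M u (v [^]\<^bsub>End_ring C Z\<^esub> (Suc k)))"
    and \<psi>: "\<forall>Z\<in>Ob C. \<forall>u\<in>mor C M Z. \<forall>v\<in>mor C Z Z. \<exists>\<psi>\<in>mor C B Z.
      Cmp C P M Z u p1 \<oplus>\<^bsub>Hom C P Z\<^esub> Cmp C P B Z (Cmp C B Z Z v \<psi>) p2
      = Cmp C P B Z \<psi> q1 \<oplus>\<^bsub>Hom C P Z\<^esub> Cmp C P M Z (Cmp C M Z Z (v [^]\<^bsub>End_ring C Z\<^esub> (Suc k)) u) q2"
    by blast
  note d = biproductD[OF bi M B] biproductD(2-)[OF bj B M] M B
  obtain Q I1 I2 R1 R2 where b: "biproduct C M P Q I1 I2 R1 R2"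
    using biproducts M d(1) by blast
  note e = biproductD[OF b M d(1)]
  \<comment> \<open>The new \<open>B\<close> is \<open>P\<close>. The splitting of
    \<open>Q = M \<oplus> P\<close> at its last summand is built recursively: the first summand is
    left alone and the remaining \<open>P\<close> is split by the old \<open>j1\<close>,
    \<open>j2\<close>, \<open>q1\<close>, \<open>q2\<close>.\<close>
  define J1 where "J1 = Cmp C P M Q I1 p1 \<oplus>\<^bsub>Hom C P Q\<^esub> Cmp C P P Q I2 (Cmp C P B P j1 p2)"
  define J2 where "J2 = Cmp C M P Q I2 j2"
  define Q1 where "Q1 = Cmp C Q M P i1 R1 \<oplus>\<^bsub>Hom C Q P\<^esub> Cmp C Q P P (Cmp C P B P i2 q1) R2"
  define Q2 where "Q2 = Cmp C Q P M q2 R2"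
  have t: "J1 \<in> mor C P Q" "J2 \<in> mor C M Q" "Q1 \<in> mor C Q P" "Q2 \<in> mor C Q M"
    using d e by (simp_all add: J1_def J2_def Q1_def Q2_def)
  have eq: "Cmp C P Q P Q1 J1 = Idt C P"
    using d e biproduct_decompose(1)[OF bi M B] unfolding J1_def Q1_def
    by (simp add: cmp_distrib)
  have eq2: "Cmp C M Q M Q2 J2 = Idt C M" "Cmp C M Q P Q1 J2 = zero_mor C M P" "Cmp C P Q M Q2 J1 = zero_mor C P M"
    using d e unfolding J1_def J2_def Q1_def Q2_def by (simp_all add: cmp_distrib)
  have "Cmp C Q P Q J1 Q1 \<oplus>\<^bsub>Hom C Q Q\<^esub> Cmp C Q M Q J2 Q2 =
     Cmp C Q M Q I1 R1 \<oplus>\<^bsub>Hom C Q Q\<^esub> Cmp C Q P Q I2 (Cmp C Q B P j1 (Cmp C Q P B q1 R2) \<oplus>\<^bsub>Hom C Q P\<^esub> Cmp C Q M P j2 (Cmp C Q P M q2 R2))"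
    using d e unfolding J1_def J2_def Q1_def Q2_def by (simp add: cmp_distrib)
  also have "\<dots> = Idt C Q"
    using d e biproduct_decompose(2)[OF bj B M, of Q R2] biproduct_decompose(1)[OF b M] by simp
  finally have b': "biproduct C P M Q J1 J2 Q1 Q2"
    using t eq eq2 e by (simp add: biproduct_def)
  \<comment> \<open>The new shifts are \<open>j1 p2\<close> and \<open>i2 q1\<close>, the factors of
    the old ones in the opposite order, so \<open>pow_cycle\<close> raises the exponent by exactly
    one.\<close>
  have s': "Cmp C P Q P R2 J1 = Cmp C P B P j1 p2" and r': "Cmp C P Q P Q1 I2 = Cmp C P B P i2 q1"
    using d e unfolding J1_def Q1_def by (simp_all add: cmp_distrib)
  have s'': "(Cmp C P Q P R2 J1) [^]\<^bsub>End_ring C P\<^esub> (Suc (Suc k)) = zero_mor C P P"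
    unfolding s' pow_cycle[OF B \<open>P \<in> Ob C\<close> \<open>j1 \<in> mor C B P\<close> \<open>p2 \<in> mor C P B\<close>] s using d by simp
  have r'': "(Cmp C P Q P Q1 I2) [^]\<^bsub>End_ring C P\<^esub> (Suc (Suc k)) = zero_mor C P P"
    unfolding r' pow_cycle[OF B \<open>P \<in> Ob C\<close> \<open>i2 \<in> mor C B P\<close> \<open>q1 \<in> mor C P B\<close>] r using d by simp
  have \<phi>': "\<exists>\<phi>\<in>mor C Z P.
      Cmp C Z M Q I1 u \<oplus>\<^bsub>Hom C Z Q\<^esub> Cmp C Z P Q I2 (Cmp C Z Z P \<phi> v)
      = Cmp C Z P Q J1 \<phi> \<oplus>\<^bsub>Hom C Z Q\<^esub> Cmp C Z M Q J2 (Cmp C Z Z M u (v [^]\<^bsub>End_ring C Z\<^esub> (Suc (Suc k))))"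
    if Z: "Z \<in> Ob C" "u \<in> mor C Z M" "v \<in> mor C Z Z" for Z u v
  proof -
    obtain \<phi> where f: "\<phi> \<in> mor C Z B"
      "Cmp C Z M P i1 u \<oplus>\<^bsub>Hom C Z P\<^esub> Cmp C Z B P i2 (Cmp C Z Z B \<phi> v)
      = Cmp C Z B P j1 \<phi> \<oplus>\<^bsub>Hom C Z P\<^esub> Cmp C Z M P j2 (Cmp C Z Z M u (v [^]\<^bsub>End_ring C Z\<^esub> (Suc k)))"
      using \<phi> Z by blast
    \<comment> \<open>The next \<open>\<phi>\<close> is the common value of both sides of
      \<open>f(2)\<close>: the left side is used to compute \<open>J1 ?f\<close>, the right side to
      compute \<open>?f v\<close>.\<close>
    let ?f = "Cmp C Z M P i1 u \<oplus>\<^bsub>Hom C Z P\<^esub> Cmp C Z B P i2 (Cmp C Z Z B \<phi> v)"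
    have 1: "Cmp C Z P Q J1 ?f = Cmp C Z M Q I1 u \<oplus>\<^bsub>Hom C Z Q\<^esub> Cmp C Z P Q I2 (Cmp C Z B P j1 (Cmp C Z Z B \<phi> v))"
      using d e Z f(1) unfolding J1_def by (simp add: cmp_distrib)
    have 2: "Cmp C Z Z P ?f v = Cmp C Z B P j1 (Cmp C Z Z B \<phi> v) \<oplus>\<^bsub>Hom C Z P\<^esub>
        Cmp C Z M P j2 (Cmp C Z Z M u (v [^]\<^bsub>End_ring C Z\<^esub> (Suc (Suc k))))"
      unfolding f(2) using d e Z f(1) by (simp add: cmp_distrib)
    have "Cmp C Z M Q I1 u \<oplus>\<^bsub>Hom C Z Q\<^esub> Cmp C Z P Q I2 (Cmp C Z Z P ?f v)
      = Cmp C Z P Q J1 ?f \<oplus>\<^bsub>Hom C Z Q\<^esub> Cmp C Z M Q J2 (Cmp C Z Z M u (v [^]\<^bsub>End_ring C Z\<^esub> (Suc (Suc k))))"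
      unfolding 1 2 J2_def using d e Z f(1) by (simp add: cmp_distrib)
    with d e Z f(1) show ?thesis by (intro bexI[of _ ?f]) auto
  qed
  have \<psi>': "\<exists>\<psi>\<in>mor C P Z.
      Cmp C Q M Z u R1 \<oplus>\<^bsub>Hom C Q Z\<^esub> Cmp C Q P Z (Cmp C P Z Z v \<psi>) R2
      = Cmp C Q P Z \<psi> Q1 \<oplus>\<^bsub>Hom C Q Z\<^esub> Cmp C Q M Z (Cmp C M Z Z (v [^]\<^bsub>End_ring C Z\<^esub> (Suc (Suc k))) u) Q2"
    if Z: "Z \<in> Ob C" "u \<in> mor C M Z" "v \<in> mor C Z Z" for Z u v
  proof -
    obtain \<psi> where f: "\<psi> \<in> mor C B Z"
      "Cmp C P M Z u p1 \<oplus>\<^bsub>Hom C P Z\<^esub> Cmp C P B Z (Cmp C B Z Z v \<psi>) p2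
      = Cmp C P B Z \<psi> q1 \<oplus>\<^bsub>Hom C P Z\<^esub> Cmp C P M Z (Cmp C M Z Z (v [^]\<^bsub>End_ring C Z\<^esub> (Suc k)) u) q2"
      using \<psi> Z by blast
    let ?f = "Cmp C P M Z u p1 \<oplus>\<^bsub>Hom C P Z\<^esub> Cmp C P B Z (Cmp C B Z Z v \<psi>) p2"
    have 1: "Cmp C Q P Z ?f Q1 = Cmp C Q M Z u R1 \<oplus>\<^bsub>Hom C Q Z\<^esub> Cmp C Q P Z (Cmp C P B Z (Cmp C B Z Z v \<psi>) q1) R2"
      using d e Z f(1) unfolding Q1_def by (simp add: cmp_distrib)
    have 2: "Cmp C P Z Z v ?f = Cmp C P B Z (Cmp C B Z Z v \<psi>) q1 \<oplus>\<^bsub>Hom C P Z\<^esub>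
        Cmp C P M Z (Cmp C M Z Z (v [^]\<^bsub>End_ring C Z\<^esub> (Suc (Suc k))) u) q2"
      unfolding f(2) pow_Suc2[OF Z(3,1), of "Suc k", symmetric] using d e Z f(1)
      by (simp add: cmp_distrib del: nat_pow_Suc)
    have "Cmp C Q M Z u R1 \<oplus>\<^bsub>Hom C Q Z\<^esub> Cmp C Q P Z (Cmp C P Z Z v ?f) R2
      = Cmp C Q P Z ?f Q1 \<oplus>\<^bsub>Hom C Q Z\<^esub> Cmp C Q M Z (Cmp C M Z Z (v [^]\<^bsub>End_ring C Z\<^esub> (Suc (Suc k))) u) Q2"
      unfolding 1 2 Q2_def using d e Z f(1) by (simp add: cmp_distrib)
    with d e Z f(1) show ?thesis by (intro bexI[of _ ?f]) auto
  qed
  show ?case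
    using \<open>P \<in> Ob C\<close> b b' s'' r'' \<phi>' \<psi>' by blast
qed

end

section \<open>Triangles\<close>

context additive_category
begin

lemma zero_objectI:
  assumes "X \<in> Ob C" "Idt C X = zero_mor C X X"
  shows "is_zero_object C X"
  unfolding is_zero_object_def
proof (intro conjI ballI equalityI subsetI)
  fix Y f assume Y: "Y \<in> Ob C"
  show "f \<in> mor C Y X \<Longrightarrow> f \<in> {zero_mor C Y X}"
    using assms Y idt_left[of Y X f] by simp
  show "f \<in> mor C X Y \<Longrightarrow> f \<in> {zero_mor C X Y}"
    using assms Y idt_right[of X Y f] by simp
qed (use assms in auto)

lemma zero_objectD:
  assumes "is_zero_object C X"
  shows "X \<in> Ob C" "Idt C X = zero_mor C X X"
proof -
  show "X \<in> Ob C" using assms by (simp add: is_zero_object_def)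
  then show "Idt C X = zero_mor C X X"
    using assms idt_closed[of X] by (auto simp: is_zero_object_def)
qed

text \<open>With \<open>X\<close> itself as \<open>X \<oplus> 0\<close>, adding a triangle with a
  zero vertex leaves the corresponding vertex unchanged.\<close>

lemma biproduct_zero:
  assumes "X \<in> Ob C" "is_zero_object C O'"
  shows "biproduct C X O' X (Idt C X) (zero_mor C O' X) (Idt C X) (zero_mor C X O')"
  using assms(1) zero_objectD(1,2)[OF assms(2)] by (simp add: biproduct_def)

end

section \<open>The shift, exactness and direct sums of triangles\<close>

context triangulated_category
begin

sublocale shift: linear_equivalence K C C "Shift C"
  by (rule shift_equivalence)

declare shift.ob_closed [simp] shift.mor_closed [simp] shift.map_idt [simp]

lemma shm_zero [simp]:
  "\<lbrakk>X \<in> Ob C; Y \<in> Ob C\<rbrakk> \<Longrightarrow> shm C X Y (zero_mor C X Y) = zero_mor C (sh C X) (sh C Y)"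
  using shift.map_add[of X Y "zero_mor C X Y" "zero_mor C X Y"]
  by (intro zero_if_add_self) auto

lemma shm_neg [simp]:
  "\<lbrakk>X \<in> Ob C; Y \<in> Ob C; f \<in> mor C X Y\<rbrakk>
    \<Longrightarrow> shm C X Y (\<ominus>\<^bsub>Hom C X Y\<^esub> f) = \<ominus>\<^bsub>Hom C (sh C X) (sh C Y)\<^esub> (shm C X Y f)"
  using shift.map_add[of X Y f "\<ominus>\<^bsub>Hom C X Y\<^esub> f"]
  by (intro neg_unique) auto

lemma shm_full:
  assumes "X \<in> Ob C" "Y \<in> Ob C" "g \<in> mor C (sh C X) (sh C Y)"
  obtains f where "f \<in> mor C X Y" "g = shm C X Y f"
  using shift.fully_faithful[OF assms(1,2)] assms(3) by (auto simp: bij_betw_def)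

lemma shm_faithful:
  assumes "shm C X Y f = shm C X Y g" "X \<in> Ob C" "Y \<in> Ob C" "f \<in> mor C X Y" "g \<in> mor C X Y"
  shows "f = g"
  using shift.fully_faithful[OF assms(2,3)] assms by (auto simp: bij_betw_def inj_on_def)

lemma shm_pow:
  assumes "X \<in> Ob C" "v \<in> mor C X X"
  shows "shm C X X (v [^]\<^bsub>End_ring C X\<^esub> (n::nat)) = (shm C X X v) [^]\<^bsub>End_ring C (sh C X)\<^esub> n"
  using assms by (induction n) (simp_all add: shift.map_cmp)

lemma biproduct_shift:
  assumes "biproduct C X Y P i1 i2 p1 p2" "X \<in> Ob C" "Y \<in> Ob C"
  shows "biproduct C (sh C X) (sh C Y) (sh C P) (shm C X P i1) (shm C Y P i2) (shm C P X p1) (shm C P Y p2)"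
proof -
  note d = biproductD[OF assms] assms(2,3)
  show ?thesis
    unfolding biproduct_def
    using d biproduct_decompose(1)[OF assms]
    by (simp flip: shift.map_cmp shift.map_add)
qed

lemma zero_object_shift: "is_zero_object C X \<Longrightarrow> is_zero_object C (sh C X)"
  using zero_objectD(1,2)[of X] shift.map_idt[of X] by (intro zero_objectI) auto

lemma triD:
  assumes "(X, Y, Z, f, g, h) \<in> Tri C"
  shows "X \<in> Ob C" "Y \<in> Ob C" "Z \<in> Ob C" "f \<in> mor C X Y" "g \<in> mor C Y Z" "h \<in> mor C Z (sh C X)"
  using tri_candidate[OF assms] by auto

lemma tri_rotate:
  "(X, Y, Z, f, g, h) \<in> Tri C \<Longrightarrow>
    (Y, Z, sh C X, g, h, \<ominus>\<^bsub>Hom C (sh C X) (sh C Y)\<^esub> (shm C X Y f)) \<in> Tri C"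
  using TR2 tri_candidate by blast

text \<open>\<open>TR1_idt\<close> accepts any zero object, so it is applied with
  \<open>sh C O'\<close> and the triangle is rotated back.\<close>

lemma tri_zero_idt:
  assumes "U \<in> Ob C" "is_zero_object C O'"
  shows "(O', U, U, zero_mor C O' U, Idt C U, zero_mor C U (sh C O')) \<in> Tri C"
  using TR1_idt[OF assms(1) zero_object_shift[OF assms(2)]] assms zero_objectD(1)[OF assms(2)]
    TR2[of O' U U "zero_mor C O' U" "Idt C U" "zero_mor C U (sh C O')"] by simp

lemma tri_idt_zero_rotated:
  assumes "U \<in> Ob C" "is_zero_object C O'"
  shows "(U, O', sh C U, zero_mor C U O', zero_mor C O' (sh C U), \<ominus>\<^bsub>Hom C (sh C U) (sh C U)\<^esub> (Idt C (sh C U))) \<in> Tri C"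
  using tri_rotate[OF TR1_idt[OF assms]] assms(1) by simp

text \<open>Exactness of \<open>Hom(-, U)\<close> at \<open>Z\<close>: \<open>TR3\<close> extends
  \<open>(0, c)\<close> to a morphism from the rotated triangle to
  \<open>0 \<rightarrow> U \<rightarrow> U\<close>, and its third component is the factor.\<close>

lemma tri_factor_cone:
  assumes t: "(X, Y, Z, f, g, h) \<in> Tri C" and "U \<in> Ob C" "c \<in> mor C Z U" "Cmp C Y Z U c g = zero_mor C Y U"
  obtains c' where "c' \<in> mor C (sh C X) U" "c = Cmp C Z (sh C X) U c' h"
proof -
  note d = triD[OF t] assms(2-)
  obtain O' where O: "is_zero_object C O'" using zero_object by blast
  note o = zero_objectD[OF O]
  note t' = tri_zero_idt[OF \<open>U \<in> Ob C\<close> O]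
  obtain c' where "triangle_morphism C (Y, Z, sh C X, g, h, \<ominus>\<^bsub>Hom C (sh C X) (sh C Y)\<^esub> (shm C X Y f))
      (O', U, U, zero_mor C O' U, Idt C U, zero_mor C U (sh C O')) (zero_mor C Y O') c c'"
    using TR3[OF tri_rotate[OF t] t', of "zero_mor C Y O'" c] d o(1) by auto
  then show ?thesis
    using d that[of c'] by simp
qed

text \<open>Exactness of \<open>Hom(U, -)\<close> at \<open>Z\<close>: \<open>TR3\<close> maps
  \<open>U \<rightarrow> 0 \<rightarrow> U[1]\<close> to the twice rotated triangle.\<close>

lemma tri_factor_fibre:
  assumes t: "(X, Y, Z, f, g, h) \<in> Tri C" and "U \<in> Ob C" "c \<in> mor C U Z" "Cmp C U Z (sh C X) h c = zero_mor C U (sh C X)"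
  obtains c' where "c' \<in> mor C U Y" "c = Cmp C U Y Z g c'"
proof -
  note d = triD[OF t] assms(2-)
  obtain O' where O: "is_zero_object C O'" using zero_object by blast
  note o = zero_objectD[OF O]
  note t' = tri_idt_zero_rotated[OF \<open>U \<in> Ob C\<close> O]
  obtain c' where c': "triangle_morphism C
      (U, O', sh C U, zero_mor C U O', zero_mor C O' (sh C U), \<ominus>\<^bsub>Hom C (sh C U) (sh C U)\<^esub> (Idt C (sh C U)))
      (Z, sh C X, sh C Y, h, \<ominus>\<^bsub>Hom C (sh C X) (sh C Y)\<^esub> (shm C X Y f), \<ominus>\<^bsub>Hom C (sh C Y) (sh C Z)\<^esub> (shm C Y Z g))
      c (zero_mor C O' (sh C X)) c'"
    using TR3[OF t' tri_rotate[OF tri_rotate[OF t]], of c "zero_mor C O' (sh C X)"] d o(1) by auto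
  then have m: "c' \<in> mor C (sh C U) (sh C Y)" by simp
  \<comment> \<open>\<open>TR3\<close> only gives a map \<open>U[1] \<rightarrow> Y[1]\<close>.
    Fullness of the shift desuspends it, and faithfulness desuspends the resulting equation once the
    signs from the rotations are cancelled.\<close>
  then obtain s where s: "s \<in> mor C U Y" "c' = shm C U Y s"
    using shm_full[of U Y c'] d by auto
  have "\<ominus>\<^bsub>Hom C (sh C U) (sh C Z)\<^esub> (shm C U Z c) = \<ominus>\<^bsub>Hom C (sh C U) (sh C Z)\<^esub> (shm C U Z (Cmp C U Y Z g s))"
    using c' d s by (simp add: shift.map_cmp)
  then have "\<ominus>\<^bsub>Hom C (sh C U) (sh C Z)\<^esub> (\<ominus>\<^bsub>Hom C (sh C U) (sh C Z)\<^esub> (shm C U Z c))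
     = \<ominus>\<^bsub>Hom C (sh C U) (sh C Z)\<^esub> (\<ominus>\<^bsub>Hom C (sh C U) (sh C Z)\<^esub> (shm C U Z (Cmp C U Y Z g s)))"
    by simp
  then have "shm C U Z c = shm C U Z (Cmp C U Y Z g s)"
    using d s(1) by (simp del: shift.map_cmp)
  then have "c = Cmp C U Y Z g s"
    by (rule shm_faithful) (use d s(1) in auto)
  with s(1) show ?thesis using that by blast
qed

lemma tri_isoI:
  assumes "(X, Y, Z, f, g, h) \<in> Tri C"
    and "is_iso C X X' a" "is_iso C Y Y' b" "is_iso C Z Z' c"
    and "triangle_morphism C (X, Y, Z, f, g, h) (X', Y', Z', f', g', h') a b c"
    and "candidate_triangle C (X', Y', Z', f', g', h')"
  shows "(X', Y', Z', f', g', h') \<in> Tri C"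
  using assms by (intro TR1_iso[OF assms(1,6)]) (simp only: triangle_isomorphic.simps, blast)

text \<open>
  For a distinguished triangle the last hypothesis holds automatically, so that both composites of
  \<open>c\<close> and \<open>d\<close> are unipotent.
\<close>

lemma tri_cone_criterion:
  assumes t: "(X, Y, Z, f, g, h) \<in> Tri C"
    and Z': "Z' \<in> Ob C" "g' \<in> mor C Y Z'" "h' \<in> mor C Z' (sh C X)"
    and c: "c \<in> mor C Z Z'" "Cmp C Y Z Z' c g = g'" "Cmp C Z Z' (sh C X) h' c = h"
    and d: "d \<in> mor C Z' Z" "Cmp C Y Z' Z d g' = g" "Cmp C Z' Z (sh C X) h d = h'"
    and sq: "\<And>e. \<lbrakk>e \<in> mor C Z' Z'; Cmp C Y Z' Z' e g' = zero_mor C Y Z'; Cmp C Z' Z' (sh C X) h' e = zero_mor C Z' (sh C X)\<rbrakk>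
      \<Longrightarrow> Cmp C Z' Z' Z' e e = zero_mor C Z' Z'"
  shows "(X, Y, Z', f, g', h') \<in> Tri C"
proof -
  note x = triD[OF t] Z'
  \<comment> \<open>The error \<open>d c - 1\<close> vanishes on \<open>g\<close> and under
    \<open>h\<close>. Hence it factors as \<open>e' h\<close>, and its square \<open>e' h ?e\<close>
    is zero.\<close>
  let ?e = "Cmp C Z Z' Z d c \<oplus>\<^bsub>Hom C Z Z\<^esub> \<ominus>\<^bsub>Hom C Z Z\<^esub> (Idt C Z)"
  have e: "?e \<in> mor C Z Z" "Cmp C Y Z Z ?e g = zero_mor C Y Z" "Cmp C Z Z (sh C X) h ?e = zero_mor C Z (sh C X)"
    using x c d by (simp_all add: cmp_add_left cmp_add_right cmp_assoc)
      (simp flip: cmp_assoc)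
  obtain e' where e': "e' \<in> mor C (sh C X) Z" "?e = Cmp C Z (sh C X) Z e' h"
    using tri_factor_cone[OF t x(3) e(1,2)] by blast
  have "Cmp C Z Z Z ?e ?e = Cmp C Z Z Z (Cmp C Z (sh C X) Z e' h) ?e"
    using e'(2) by simp
  also have "\<dots> = zero_mor C Z Z"
    using x e(1,3) e'(1) by (simp add: cmp_assoc del: cmp_add_left cmp_add_right)
  finally obtain y where y: "y \<in> mor C Z Z" "Cmp C Z Z Z y (Cmp C Z Z' Z d c) = Idt C Z"
    using unipotent_inverse[OF x(3) _ refl] x c d by (metis cmp_closed)
  \<comment> \<open>For the other composite no exactness at \<open>Z'\<close> is available yet, so
    \<open>sq\<close> takes the place of the factorization.\<close>
  let ?k = "Cmp C Z' Z Z' c d \<oplus>\<^bsub>Hom C Z' Z'\<^esub> \<ominus>\<^bsub>Hom C Z' Z'\<^esub> (Idt C Z')"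
  have k: "?k \<in> mor C Z' Z'" "Cmp C Y Z' Z' ?k g' = zero_mor C Y Z'" "Cmp C Z' Z' (sh C X) h' ?k = zero_mor C Z' (sh C X)"
    using x c d by (simp_all add: cmp_add_left cmp_add_right cmp_assoc)
      (simp flip: cmp_assoc)
  obtain z where z: "z \<in> mor C Z' Z'" "Cmp C Z' Z' Z' (Cmp C Z' Z Z' c d) z = Idt C Z'"
    using unipotent_inverse[OF \<open>Z' \<in> Ob C\<close> _ refl sq[OF k]] x c d by (metis cmp_closed)
  \<comment> \<open>The left inverse \<open>y d\<close> and the right inverse \<open>d z\<close>
    come from different composites; \<open>is_isoI\<close> identifies them.\<close>
  have i: "is_iso C Z Z' c"
    using is_isoI[of Z Z' c "Cmp C Z' Z Z y d" "Cmp C Z' Z' Z d z"] x c(1) d(1) y z by (simp add: cmp_assoc)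
  show ?thesis
    by (rule tri_isoI[OF t is_iso_idt(1) is_iso_idt(1) i]) (use x c in simp_all)
qed

text \<open>The cone \<open>E\<close> of the sum map is compared with \<open>D\<close>:
  \<open>TR3\<close> applied to the injections and projections gives maps both ways, and
  \<open>tri_cone_criterion\<close> concludes.\<close>

lemma tri_biproduct:
  assumes t: "(X, Y, Z, f, g, h) \<in> Tri C" and t': "(X', Y', Z', f', g', h') \<in> Tri C"
    and A: "biproduct C X X' A a1 a2 r1 r2" and B: "biproduct C Y Y' B b1 b2 s1 s2"
    and D: "biproduct C Z Z' D d1 d2 t1 t2"
  shows "(A, B, D,
    Cmp C A Y B b1 (Cmp C A X Y f r1) \<oplus>\<^bsub>Hom C A B\<^esub> Cmp C A Y' B b2 (Cmp C A X' Y' f' r2),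
    Cmp C B Z D d1 (Cmp C B Y Z g s1) \<oplus>\<^bsub>Hom C B D\<^esub> Cmp C B Z' D d2 (Cmp C B Y' Z' g' s2),
    Cmp C D (sh C X) (sh C A) (shm C X A a1) (Cmp C D Z (sh C X) h t1) \<oplus>\<^bsub>Hom C D (sh C A)\<^esub>
    Cmp C D (sh C X') (sh C A) (shm C X' A a2) (Cmp C D Z' (sh C X') h' t2)) \<in> Tri C"
    (is "(A, B, D, ?f, ?g, ?h) \<in> _")
proof -
  note d = triD[OF t] triD[OF t']
  note x = d biproductD[OF A d(1,7)] biproductD[OF B d(2,8)] biproductD[OF D d(3,9)]
  note xs = biproductD[OF biproduct_shift[OF A d(1,7)] shift.ob_closed[OF d(1)] shift.ob_closed[OF d(7)]]
  have f: "?f \<in> mor C A B" and g: "?g \<in> mor C B D" and h: "?h \<in> mor C D (sh C A)"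
    using x by simp_all
  obtain E G H where te: "(A, B, E, ?f, G, H) \<in> Tri C"
    using TR1_cone[OF _ _ f] x by blast
  note e = triD[OF te]
  obtain c where c: "c \<in> mor C Z E" "Cmp C Y Z E c g = Cmp C Y B E G b1"
      "Cmp C Z (sh C X) (sh C A) (shm C X A a1) h = Cmp C Z E (sh C A) H c"
    using TR3[OF t te, of a1 b1] x by (auto simp: cmp_add_left cmp_add_right cmp_assoc)
  obtain c' where c': "c' \<in> mor C Z' E" "Cmp C Y' Z' E c' g' = Cmp C Y' B E G b2"
      "Cmp C Z' (sh C X') (sh C A) (shm C X' A a2) h' = Cmp C Z' E (sh C A) H c'"
    using TR3[OF t' te, of a2 b2] x by (auto simp: cmp_add_left cmp_add_right cmp_assoc)
  obtain p where p: "p \<in> mor C E Z" "Cmp C B E Z p G = Cmp C B Y Z g s1"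
      "Cmp C E (sh C A) (sh C X) (shm C A X r1) H = Cmp C E Z (sh C X) h p"
    using TR3[OF te t, of r1 s1] x by (auto simp: cmp_add_left cmp_add_right cmp_assoc)
  obtain p' where p': "p' \<in> mor C E Z'" "Cmp C B E Z' p' G = Cmp C B Y' Z' g' s2"
      "Cmp C E (sh C A) (sh C X') (shm C A X' r2) H = Cmp C E Z' (sh C X') h' p'"
    using TR3[OF te t', of r2 s2] x by (auto simp: cmp_add_left cmp_add_right cmp_assoc)
  let ?c = "Cmp C E Z D d1 p \<oplus>\<^bsub>Hom C E D\<^esub> Cmp C E Z' D d2 p'"
  let ?d = "Cmp C D Z E c t1 \<oplus>\<^bsub>Hom C D E\<^esub> Cmp C D Z' E c' t2"
  show ?thesis
  proof (rule tri_cone_criterion[OF te \<open>D \<in> Ob C\<close> g h, of ?c ?d])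
    show "?c \<in> mor C E D" "?d \<in> mor C D E"
      using x e c(1) c'(1) p(1) p'(1) by simp_all
    show "Cmp C B E D ?c G = ?g"
      using x e p(1,2) p'(1,2) by (simp add: cmp_add_left cmp_assoc)
    show "Cmp C E D (sh C A) ?h ?c = H"
      using x e xs p(1) p'(1) biproduct_decompose(2)[OF biproduct_shift[OF A d(1,7)], of E H]
      by (simp add: cmp_distrib p(3) p'(3))
    show "Cmp C B D E ?d ?g = G"
    proof -
      have "Cmp C B D E ?d ?g = Cmp C B Y E (Cmp C Y Z E c g) s1 \<oplus>\<^bsub>Hom C B E\<^esub> Cmp C B Y' E (Cmp C Y' Z' E c' g') s2"
        using x e c(1) c'(1) by (simp add: cmp_distrib)
      also have "\<dots> = G"
        unfolding c(2) c'(2) using x e biproduct_decompose(3)[OF B d(2,8), of E G] by simp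
      finally show ?thesis .
    qed
    show "Cmp C D E (sh C A) H ?d = ?h"
    proof -
      have "Cmp C D E (sh C A) H ?d = Cmp C D Z (sh C A) (Cmp C Z E (sh C A) H c) t1 \<oplus>\<^bsub>Hom C D (sh C A)\<^esub>
          Cmp C D Z' (sh C A) (Cmp C Z' E (sh C A) H c') t2"
        using x e c(1) c'(1) by (simp add: cmp_distrib)
      also have "\<dots> = ?h"
        unfolding c(3)[symmetric] c'(3)[symmetric] using x xs by (simp add: cmp_assoc)
      finally show ?thesis .
    qed
    \<comment> \<open>By exactness of the two given triangles both components of \<open>q\<close>
      factor through \<open>g\<close> and \<open>g'\<close>, and \<open>q\<close> vanishes on
      \<open>d1 g\<close> and \<open>d2 g'\<close>; so \<open>q q = 0\<close>.\<close>
    fix q assume q: "q \<in> mor C D D" "Cmp C B D D q ?g = zero_mor C B D" "Cmp C D D (sh C A) ?h q = zero_mor C D (sh C A)"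
    have "Cmp C Y B D (Cmp C B D D q ?g) b1 = zero_mor C Y D" "Cmp C Y' B D (Cmp C B D D q ?g) b2 = zero_mor C Y' D"
      unfolding q(2) using x by simp_all
    then have q1: "Cmp C Y D D q (Cmp C Y Z D d1 g) = zero_mor C Y D" "Cmp C Y' D D q (Cmp C Y' Z' D d2 g') = zero_mor C Y' D"
      using x q(1) by (simp_all add: cmp_distrib)
    have "Cmp C D (sh C A) (sh C X) (shm C A X r1) (Cmp C D D (sh C A) ?h q) = zero_mor C D (sh C X)"
      "Cmp C D (sh C A) (sh C X') (shm C A X' r2) (Cmp C D D (sh C A) ?h q) = zero_mor C D (sh C X')"
      unfolding q(3) using x by simp_all
    then have q2: "Cmp C D Z (sh C X) h (Cmp C D D Z t1 q) = zero_mor C D (sh C X)"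
      "Cmp C D Z' (sh C X') h' (Cmp C D D Z' t2 q) = zero_mor C D (sh C X')"
      using x xs q(1) by (simp_all add: cmp_distrib)
    obtain l where l: "l \<in> mor C D Y" "Cmp C D D Z t1 q = Cmp C D Y Z g l"
      using tri_factor_fibre[OF t _ _ q2(1)] x q(1) by auto
    obtain l' where l': "l' \<in> mor C D Y'" "Cmp C D D Z' t2 q = Cmp C D Y' Z' g' l'"
      using tri_factor_fibre[OF t' _ _ q2(2)] x q(1) by auto
    have "Cmp C D D D q q = Cmp C D D D q (Cmp C D Z D d1 (Cmp C D D Z t1 q) \<oplus>\<^bsub>Hom C D D\<^esub> Cmp C D Z' D d2 (Cmp C D D Z' t2 q))"
      using biproduct_decompose(2)[OF D d(3,9), of D q] x q(1) by simp
    also have "\<dots> = Cmp C D Y D (Cmp C Y D D q (Cmp C Y Z D d1 g)) l \<oplus>\<^bsub>Hom C D D\<^esub>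
        Cmp C D Y' D (Cmp C Y' D D q (Cmp C Y' Z' D d2 g')) l'"
      unfolding l(2) l'(2) using x q(1) l(1) l'(1) by (simp add: cmp_distrib)
    also have "\<dots> = zero_mor C D D"
      unfolding q1 using x l(1) l'(1) by simp
    finally show "Cmp C D D D q q = zero_mor C D D" .
  qed
qed

text \<open>Negating the first two maps is the isomorphism \<open>(1, -1, 1)\<close>; the result is
  the threefold rotation of the conclusion, so \<open>TR2\<close> is applied backwards three
  times.\<close>

lemma tri_unshift:
  assumes t: "(sh C X, sh C Y, sh C Z, shm C X Y f, shm C Y Z g, shm C Z (sh C X) h) \<in> Tri C"
    and x: "X \<in> Ob C" "Y \<in> Ob C" "Z \<in> Ob C" "f \<in> mor C X Y" "g \<in> mor C Y Z" "h \<in> mor C Z (sh C X)"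
  shows "(X, Y, Z, f, g, \<ominus>\<^bsub>Hom C Z (sh C X)\<^esub> h) \<in> Tri C"
proof -
  let ?t = "(sh C X, sh C Y, sh C Z, \<ominus>\<^bsub>Hom C (sh C X) (sh C Y)\<^esub> (shm C X Y f),
    \<ominus>\<^bsub>Hom C (sh C Y) (sh C Z)\<^esub> (shm C Y Z g), shm C Z (sh C X) h)"
  have "?t \<in> Tri C"
    by (rule tri_isoI[OF t is_iso_idt(1) is_iso_idt(2) is_iso_idt(1)]) (use x in simp_all)
  then have "(Z, sh C X, sh C Y, \<ominus>\<^bsub>Hom C Z (sh C X)\<^esub> h, \<ominus>\<^bsub>Hom C (sh C X) (sh C Y)\<^esub> (shm C X Y f),
      \<ominus>\<^bsub>Hom C (sh C Y) (sh C Z)\<^esub> (shm C Y Z g)) \<in> Tri C"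
    using TR2[of Z "sh C X" "sh C Y" "\<ominus>\<^bsub>Hom C Z (sh C X)\<^esub> h" "\<ominus>\<^bsub>Hom C (sh C X) (sh C Y)\<^esub> (shm C X Y f)"
      "\<ominus>\<^bsub>Hom C (sh C Y) (sh C Z)\<^esub> (shm C Y Z g)"] x by simp
  then have "(Y, Z, sh C X, g, \<ominus>\<^bsub>Hom C Z (sh C X)\<^esub> h, \<ominus>\<^bsub>Hom C (sh C X) (sh C Y)\<^esub> (shm C X Y f)) \<in> Tri C"
    using TR2[of Y Z "sh C X" g "\<ominus>\<^bsub>Hom C Z (sh C X)\<^esub> h" "\<ominus>\<^bsub>Hom C (sh C X) (sh C Y)\<^esub> (shm C X Y f)"] x by simp
  then show ?thesis
    using TR2[of X Y Z f g "\<ominus>\<^bsub>Hom C Z (sh C X)\<^esub> h"] x by simp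
qed

text \<open>\<open>w^m g = g s^m = 0\<close> gives \<open>w^m = k h\<close>, while
  \<open>h w^n = v[1]^n h = 0\<close>; therefore \<open>w^(m+n) = k h w^n = 0\<close>.\<close>

lemma cone_endo_nilpotent:
  assumes t: "(X, Y, Z, f, g, h) \<in> Tri C"
    and "w \<in> mor C Z Z" "v \<in> mor C X X" "s \<in> mor C Y Y"
    and "Cmp C Y Z Z w g = Cmp C Y Y Z g s"
    and "Cmp C Z Z (sh C X) h w = Cmp C Z (sh C X) (sh C X) (shm C X X v) h"
    and "s [^]\<^bsub>End_ring C Y\<^esub> (m::nat) = zero_mor C Y Y" "v [^]\<^bsub>End_ring C X\<^esub> (n::nat) = zero_mor C X X"
  shows "nilpotent_endo C Z w"
proof -
  note d = triD[OF t] assms(2-)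
  have "Cmp C Y Z Z (w [^]\<^bsub>End_ring C Z\<^esub> m) g = zero_mor C Y Z"
    using d pow_intertwine[of Y Z g s w m] by simp
  then obtain k where k: "k \<in> mor C (sh C X) Z" "w [^]\<^bsub>End_ring C Z\<^esub> m = Cmp C Z (sh C X) Z k h"
    using tri_factor_cone[OF t, of Z "w [^]\<^bsub>End_ring C Z\<^esub> m"] d by auto
  have n: "Cmp C Z Z (sh C X) h (w [^]\<^bsub>End_ring C Z\<^esub> n) = zero_mor C Z (sh C X)"
    using d pow_intertwine[of Z "sh C X" h w "shm C X X v" n] by (simp flip: shm_pow)
  have "w [^]\<^bsub>End_ring C Z\<^esub> (m + n) = Cmp C Z (sh C X) Z k (Cmp C Z Z (sh C X) h (w [^]\<^bsub>End_ring C Z\<^esub> n))"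
    using d k by (simp add: pow_add cmp_assoc)
  also have "\<dots> = zero_mor C Z Z"
    unfolding n using d k(1) by simp
  finally show ?thesis
    using d by (auto simp: nilpotent_endo_def)
qed

end

section \<open>The two kinds of degeneration triangles\<close>

context triangulated_category
begin

text \<open>Essential surjectivity of the shift replaces the cone by an isomorphic object that can
  be desuspended.\<close>

lemma tri_cone_shift:
  assumes "X \<in> Ob C" "Y \<in> Ob C" "f \<in> mor C X Y"
  obtains A g h where "A \<in> Ob C" "(X, Y, sh C A, f, g, h) \<in> Tri C"
proof -
  obtain Z g h where t: "(X, Y, Z, f, g, h) \<in> Tri C"
    using TR1_cone[OF assms] by blast
  note d = triD[OF t]
  obtain A r s where A: "A \<in> Ob C" "r \<in> mor C (sh C A) Z" "s \<in> mor C Z (sh C A)"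
    "Cmp C (sh C A) Z (sh C A) s r = Idt C (sh C A)" "Cmp C Z (sh C A) Z r s = Idt C Z"
    using shift.essentially_surjective[OF d(3)] by (auto simp: isomorphic_def is_iso_def)
  have s: "is_iso C Z (sh C A) s"
    using A d by (intro is_isoI[of _ _ _ r r]) auto
  have "(X, Y, sh C A, f, Cmp C Y Z (sh C A) s g, Cmp C (sh C A) Z (sh C X) h r) \<in> Tri C"
    by (rule tri_isoI[OF t is_iso_idt(1) is_iso_idt(1) s]) (use A d in \<open>simp_all add: cmp_assoc\<close>)
  with A(1) show ?thesis by (rule that)
qed

text \<open>The new object is the cone \<open>W\<close> of \<open>\<phi>\<close>; its nilpotent
  endomorphism is a component of a map from the octahedral axiom.\<close>

lemma left_triangle_imp_right_triangle:
  assumes M: "M \<in> Ob C" and b0: "biproduct C Z M P0 I1 I2 R1 R2"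
    and v: "nilpotent_endo C Z v" and u: "u \<in> mor C Z M"
    and t: "(Z, P0, N, column C Z Z M P0 I1 I2 v u, g0, h0) \<in> Tri C"
  shows "\<exists>Z\<in>Ob C. \<exists>P i1 i2 p1 p2. biproduct C M Z P i1 i2 p1 p2 \<and>
    (\<exists>u v f h. nilpotent_endo C Z v \<and> u \<in> mor C M Z \<and>
      (N, P, Z, f, row C M Z P Z p1 p2 u v, h) \<in> Tri C)"
proof -
  note dt = triD[OF t] M u biproductD[OF b0 triD(1)[OF t] M]
  let ?col = "Cmp C Z Z P0 I1 v \<oplus>\<^bsub>Hom C Z P0\<^esub> Cmp C Z M P0 I2 u"
  note t = t[unfolded column_def]
  obtain k where vk: "v \<in> mor C Z Z" "v [^]\<^bsub>End_ring C Z\<^esub> (k::nat) = zero_mor C Z Z"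
    using v by (auto simp: nilpotent_endo_def)
  \<comment> \<open>The tower starts with one copy of \<open>M\<close>, so its exponent is a
    successor; this also covers \<open>k = 0\<close>.\<close>
  have vSk: "v [^]\<^bsub>End_ring C Z\<^esub> (Suc k) = zero_mor C Z Z"
    using vk dt by simp
  obtain B Q i1 i2 p1 p2 j1 j2 q1 q2 where B: "B \<in> Ob C"
    and bi: "biproduct C M B Q i1 i2 p1 p2" and bj: "biproduct C B M Q j1 j2 q1 q2"
    and s: "(Cmp C B Q B p2 j1) [^]\<^bsub>End_ring C B\<^esub> (Suc k) = zero_mor C B B"
    and \<phi>: "\<forall>Z\<in>Ob C. \<forall>u\<in>mor C Z M. \<forall>v\<in>mor C Z Z. \<exists>\<phi>\<in>mor C Z B.
      Cmp C Z M Q i1 u \<oplus>\<^bsub>Hom C Z Q\<^esub> Cmp C Z B Q i2 (Cmp C Z Z B \<phi> v)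
      = Cmp C Z B Q j1 \<phi> \<oplus>\<^bsub>Hom C Z Q\<^esub> Cmp C Z M Q j2 (Cmp C Z Z M u (v [^]\<^bsub>End_ring C Z\<^esub> (Suc k)))"
    using biproduct_tower[OF M, of k] by blast
  note db = B biproductD[OF bi M B] biproductD(2-)[OF bj B M]
  obtain \<phi> where f: "\<phi> \<in> mor C Z B"
    "Cmp C Z M Q i1 u \<oplus>\<^bsub>Hom C Z Q\<^esub> Cmp C Z B Q i2 (Cmp C Z Z B \<phi> v) = Cmp C Z B Q j1 \<phi>"
    using \<phi>[rule_format, OF dt(1) u vk(1)] dt db unfolding vSk by auto
  obtain W a b where tw: "(Z, B, W, \<phi>, a, b) \<in> Tri C"
    using TR1_cone[OF dt(1) B f(1)] by blast
  note dw = triD[OF tw]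
  obtain O' where O: "is_zero_object C O'" using zero_object by blast
  note o = zero_objectD(1,2)[OF O]
  have t0: "(M, M, O', Idt C M, zero_mor C M O', zero_mor C O' (sh C M)) \<in> Tri C"
    by (rule TR1_idt[OF M O])
  have t0': "(O', M, M, zero_mor C O' M, Idt C M, zero_mor C M (sh C O')) \<in> Tri C"
    by (rule tri_zero_idt[OF M O])
  \<comment> \<open>This is \<open>\<phi> \<oplus> 1\<close> up to the order of summands; the added
    triangle \<open>M \<rightarrow> M \<rightarrow> 0\<close> leaves the cone
    \<open>W\<close>.\<close>
  let ?G = "Cmp C P0 Z Q (Cmp C Z B Q i2 \<phi>) R1 \<oplus>\<^bsub>Hom C P0 Q\<^esub> Cmp C P0 M Q i1 R2"
  have tG: "(P0, Q, W, ?G, Cmp C Q B W a p2, Cmp C W (sh C Z) (sh C P0) (shm C Z P0 I1) b) \<in> Tri C"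
    using tri_biproduct[OF tw t0 b0 biproduct_swap[OF bi M B] biproduct_zero[OF dw(3) O]] dt db dw o
    by (simp add: cmp_assoc)
  obtain R \<alpha> \<beta> \<gamma> \<delta> where bR: "biproduct C W M R \<alpha> \<beta> \<gamma> \<delta>"
    using biproducts dw(3) M by blast
  note dR = biproductD[OF bR dw(3) M]
  \<comment> \<open>Adding \<open>0 \<rightarrow> M \<rightarrow> M\<close> instead pads
    \<open>\<phi>\<close> by zero and enlarges the cone to \<open>R = W \<oplus> M\<close>.\<close>
  let ?m = "Cmp C Q W R \<alpha> (Cmp C Q B W a q1) \<oplus>\<^bsub>Hom C Q R\<^esub> Cmp C Q M R \<beta> q2"
  have tR: "(Z, Q, R, Cmp C Z B Q j1 \<phi>, ?m, Cmp C R W (sh C Z) b \<gamma>) \<in> Tri C"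
    using tri_biproduct[OF tw t0' biproduct_zero[OF dt(1) O] bj bR] dt db dw o dR by simp
  have col: "?col \<in> mor C Z P0" "Cmp C Z P0 Q ?G ?col = Cmp C Z B Q j1 \<phi>"
    unfolding f(2)[symmetric] using dt db vk(1) f(1)
    by (simp_all add: cmp_distrib) (simp add: add_comm)
  \<comment> \<open>The octahedral axiom for \<open>?G ?col = j1 \<phi>\<close>. Of its relations
    the two containing \<open>y\<close> are kept: the first determines \<open>?w a\<close>, the
    second \<open>b ?w\<close>.\<close>
  obtain x y where y: "(N, R, W, x, y, Cmp C W (sh C P0) (sh C N) (shm C P0 N g0)
        (Cmp C W (sh C Z) (sh C P0) (shm C Z P0 I1) b)) \<in> Tri C"
      "Cmp C Q R W y ?m = Cmp C Q B W a p2"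
      "Cmp C R W (sh C P0) (Cmp C W (sh C Z) (sh C P0) (shm C Z P0 I1) b) y
        = Cmp C R (sh C Z) (sh C P0) (shm C Z P0 ?col) (Cmp C R W (sh C Z) b \<gamma>)"
    using TR4[OF t tG, of R ?m "Cmp C R W (sh C Z) b \<gamma>"] tR unfolding col(2) by blast
  note dy = triD[OF y(1)]
  \<comment> \<open>The restriction of \<open>y\<close> to the summand \<open>W\<close>. It extends
    the shift \<open>p2 j1\<close> on \<open>B\<close> and \<open>v\<close> on \<open>Z\<close>,
    both nilpotent.\<close>
  let ?w = "Cmp C W R W y \<alpha>"
  have "Cmp C B W W ?w a = Cmp C B Q W (Cmp C Q R W y ?m) j1"
    using dy dR dw db dt by (simp add: cmp_distrib)
  then have wa: "Cmp C B W W ?w a = Cmp C B B W a (Cmp C B Q B p2 j1)"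
    unfolding y(2) using dw db dt by (simp add: cmp_assoc)
  have "Cmp C W W (sh C Z) b ?w = Cmp C W (sh C P0) (sh C Z) (shm C P0 Z R1)
      (Cmp C W R (sh C P0) (Cmp C R W (sh C P0) (Cmp C W (sh C Z) (sh C P0) (shm C Z P0 I1) b) y) \<alpha>)"
    using dy dR dw db dt biproductD[OF biproduct_shift[OF b0 dt(1) M]] by (simp add: cmp_assoc)
  also have "\<dots> = Cmp C W (sh C Z) (sh C Z) (shm C Z Z (Cmp C Z P0 Z R1 ?col)) b"
    unfolding y(3) using dR dw db dt col(1) by (simp add: cmp_assoc shift.map_cmp)
  also have "Cmp C Z P0 Z R1 ?col = v"
    using dt vk(1) by (simp add: cmp_distrib)
  finally have wb: "Cmp C W W (sh C Z) b ?w = Cmp C W (sh C Z) (sh C Z) (shm C Z Z v) b" .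
  have nil: "nilpotent_endo C W ?w"
    by (rule cone_endo_nilpotent[OF tw _ vk(1) _ wa wb s vk(2)]) (use dy dR dw db dt in simp_all)
  have "row C M W R W \<delta> \<gamma> (Cmp C M R W y \<beta>) ?w = y"
    unfolding row_def using biproduct_decompose(3)[OF biproduct_swap[OF bR dw(3) M] M dw(3), of W y] dy dR dw M
    by simp
  then have "(N, R, W, x, row C M W R W \<delta> \<gamma> (Cmp C M R W y \<beta>) ?w,
      Cmp C W (sh C P0) (sh C N) (shm C P0 N g0) (Cmp C W (sh C Z) (sh C P0) (shm C Z P0 I1) b)) \<in> Tri C"
    using y(1) by simp
  moreover have "Cmp C M R W y \<beta> \<in> mor C M W"
    using dy dR M by simp
  ultimately show ?thesis
    using biproduct_swap[OF bR dw(3) M] nil dw(3) by blast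
qed

text \<open>Dual argument with \<open>\<psi> : B \<rightarrow> Z\<close>. The octahedral axiom now
  yields a triangle on \<open>A[1]\<close>, \<open>P[1]\<close>, \<open>N[1]\<close>, which has to
  be desuspended; the new object is \<open>A\<close>.\<close>

lemma right_triangle_imp_left_triangle:
  assumes M: "M \<in> Ob C" and b0: "biproduct C M Z P0 I1 I2 R1 R2"
    and v: "nilpotent_endo C Z v" and u: "u \<in> mor C M Z"
    and t: "(N, P0, Z, f0, row C M Z P0 Z R1 R2 u v, h0) \<in> Tri C"
  shows "\<exists>Z\<in>Ob C. \<exists>P i1 i2 p1 p2. biproduct C Z M P i1 i2 p1 p2 \<and>
    (\<exists>v u g h. nilpotent_endo C Z v \<and> u \<in> mor C Z M \<and>
      (Z, P, N, column C Z Z M P i1 i2 v u, g, h) \<in> Tri C)"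
proof -
  note dt = triD[OF t] M u biproductD[OF b0 M triD(3)[OF t]]
  let ?row = "Cmp C P0 M Z u R1 \<oplus>\<^bsub>Hom C P0 Z\<^esub> Cmp C P0 Z Z v R2"
  note t = t[unfolded row_def]
  obtain k where vk: "v \<in> mor C Z Z" "v [^]\<^bsub>End_ring C Z\<^esub> (k::nat) = zero_mor C Z Z"
    using v by (auto simp: nilpotent_endo_def)
  have vSk: "v [^]\<^bsub>End_ring C Z\<^esub> (Suc k) = zero_mor C Z Z"
    using vk dt by simp
  obtain B Q i1 i2 p1 p2 j1 j2 q1 q2 where B: "B \<in> Ob C"
    and bi: "biproduct C M B Q i1 i2 p1 p2" and bj: "biproduct C B M Q j1 j2 q1 q2"
    and r: "(Cmp C B Q B q1 i2) [^]\<^bsub>End_ring C B\<^esub> (Suc k) = zero_mor C B B"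
    and \<psi>: "\<forall>Z\<in>Ob C. \<forall>u\<in>mor C M Z. \<forall>v\<in>mor C Z Z. \<exists>\<psi>\<in>mor C B Z.
      Cmp C Q M Z u p1 \<oplus>\<^bsub>Hom C Q Z\<^esub> Cmp C Q B Z (Cmp C B Z Z v \<psi>) p2
      = Cmp C Q B Z \<psi> q1 \<oplus>\<^bsub>Hom C Q Z\<^esub> Cmp C Q M Z (Cmp C M Z Z (v [^]\<^bsub>End_ring C Z\<^esub> (Suc k)) u) q2"
    using biproduct_tower[OF M, of k] by blast
  note db = B biproductD[OF bi M B] biproductD(2-)[OF bj B M]
  obtain \<psi> where f: "\<psi> \<in> mor C B Z"
    "Cmp C Q M Z u p1 \<oplus>\<^bsub>Hom C Q Z\<^esub> Cmp C Q B Z (Cmp C B Z Z v \<psi>) p2 = Cmp C Q B Z \<psi> q1"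
    using \<psi>[rule_format, OF dt(3) u vk(1)] dt db unfolding vSk by auto
  obtain A a b where A: "A \<in> Ob C" and tw: "(B, Z, sh C A, \<psi>, a, b) \<in> Tri C"
    using tri_cone_shift[OF B dt(3) f(1)] by blast
  note dw = triD[OF tw] A
  obtain O' where O: "is_zero_object C O'" using zero_object by blast
  note o = zero_objectD(1,2)[OF O]
  \<comment> \<open>This is \<open>\<psi> \<oplus> 1\<close> up to the order of summands, with cone
    \<open>A[1]\<close>.\<close>
  let ?F = "Cmp C Q Z P0 I2 (Cmp C Q B Z \<psi> p2) \<oplus>\<^bsub>Hom C Q P0\<^esub> Cmp C Q M P0 I1 p1"
  have tF: "(Q, P0, sh C A, ?F, Cmp C P0 Z (sh C A) a R2, Cmp C (sh C A) (sh C B) (sh C Q) (shm C B Q i2) b) \<in> Tri C"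
    using tri_biproduct[OF tw TR1_idt[OF M O] biproduct_swap[OF bi M B] biproduct_swap[OF b0 M dt(3)]
        biproduct_zero[OF dw(3) O]] dt db dw o by simp
  obtain P \<alpha> \<beta> \<gamma> \<delta> where bP: "biproduct C A M P \<alpha> \<beta> \<gamma> \<delta>"
    using biproducts A M by blast
  note dP = biproductD[OF bP A M]
  note bR = biproduct_shift[OF bP A M]
  note dR = biproductD[OF bR shift.ob_closed[OF A] shift.ob_closed[OF M]]
  \<comment> \<open>Here \<open>\<psi>\<close> is extended by zero on \<open>M\<close>, by adding
    \<open>M \<rightarrow> 0 \<rightarrow> M[1]\<close>; the sign in \<open>?n\<close> comes from
    the rotation of that triangle.\<close>
  let ?m = "Cmp C Z (sh C A) (sh C P) (shm C A P \<alpha>) a"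
  let ?n = "Cmp C (sh C P) (sh C B) (sh C Q) (shm C B Q j1) (Cmp C (sh C P) (sh C A) (sh C B) b (shm C P A \<gamma>))
    \<oplus>\<^bsub>Hom C (sh C P) (sh C Q)\<^esub> \<ominus>\<^bsub>Hom C (sh C P) (sh C Q)\<^esub> (Cmp C (sh C P) (sh C M) (sh C Q) (shm C M Q j2) (shm C P M \<delta>))"
  have tR: "(Q, Z, sh C P, Cmp C Q B Z \<psi> q1, ?m, ?n) \<in> Tri C"
    using tri_biproduct[OF tw tri_idt_zero_rotated[OF M O] bj biproduct_zero[OF dt(3) O] bR] dt db dw o dP
    by simp
  have row: "?row \<in> mor C P0 Z" "Cmp C Q P0 Z ?row ?F = Cmp C Q B Z \<psi> q1"
    unfolding f(2)[symmetric] using dt db vk(1) f(1)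
    by (simp_all add: cmp_distrib) (simp add: add_comm)
  \<comment> \<open>The given triangle is rotated so that the row becomes its first map. The
    relations kept are those containing \<open>x\<close>, which control \<open>?w a\<close> and
    \<open>b ?w\<close>.\<close>
  obtain x y where y: "(sh C A, sh C P, sh C N, x, y,
        Cmp C (sh C N) (sh C P0) (sh C (sh C A)) (shm C P0 (sh C A) (Cmp C P0 Z (sh C A) a R2))
          (\<ominus>\<^bsub>Hom C (sh C N) (sh C P0)\<^esub> (shm C N P0 f0))) \<in> Tri C"
      "Cmp C P0 (sh C A) (sh C P) x (Cmp C P0 Z (sh C A) a R2) = Cmp C P0 Z (sh C P) ?m ?row"
      "Cmp C (sh C A) (sh C P) (sh C Q) ?n x = Cmp C (sh C A) (sh C B) (sh C Q) (shm C B Q i2) b"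
    using TR4[OF tF tri_rotate[OF t], of "sh C P" ?m ?n] tR unfolding row(2) by blast
  note dy = triD[OF y(1)]
  let ?w = "Cmp C (sh C A) (sh C P) (sh C A) (shm C P A \<gamma>) x"
  have "Cmp C Z (sh C A) (sh C A) ?w a = Cmp C Z (sh C P) (sh C A) (shm C P A \<gamma>)
      (Cmp C Z P0 (sh C P) (Cmp C P0 (sh C A) (sh C P) x (Cmp C P0 Z (sh C A) a R2)) I2)"
    using dy dR dP dw dt by (simp add: cmp_assoc)
  also have "\<dots> = Cmp C Z Z (sh C A) a v"
    unfolding y(2) using dy dR dP dw dt vk(1) by (simp add: cmp_distrib)
  finally have wa: "Cmp C Z (sh C A) (sh C A) ?w a = Cmp C Z Z (sh C A) a v" .
  have "Cmp C (sh C A) (sh C A) (sh C B) b ?w = Cmp C (sh C A) (sh C Q) (sh C B) (shm C Q B q1)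
      (Cmp C (sh C A) (sh C P) (sh C Q) ?n x)"
    using dy dR dP dw dt db biproductD[OF biproduct_shift[OF bj B M]] by (simp add: cmp_distrib)
  also have "\<dots> = Cmp C (sh C A) (sh C B) (sh C B) (shm C B B (Cmp C B Q B q1 i2)) b"
    unfolding y(3) using dw db by (simp add: cmp_assoc shift.map_cmp)
  finally have wb: "Cmp C (sh C A) (sh C A) (sh C B) b ?w
    = Cmp C (sh C A) (sh C B) (sh C B) (shm C B B (Cmp C B Q B q1 i2)) b" .
  have nil: "nilpotent_endo C (sh C A) ?w"
    by (rule cone_endo_nilpotent[OF tw _ _ vk(1) wa wb vk(2) r]) (use dy dR dP dw db dt in simp_all)
  \<comment> \<open>All three maps are desuspended by fullness, as \<open>tri_unshift\<close>
    requires.\<close>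
  obtain x' where x': "x' \<in> mor C A P" "x = shm C A P x'"
    using shm_full[OF A dP(1) dy(4)] by blast
  obtain y' where y': "y' \<in> mor C P N" "y = shm C P N y'"
    using shm_full[OF dP(1) dt(1) dy(5)] by blast
  obtain z where z: "z \<in> mor C N (sh C A)" "Cmp C (sh C N) (sh C P0) (sh C (sh C A))
      (shm C P0 (sh C A) (Cmp C P0 Z (sh C A) a R2)) (\<ominus>\<^bsub>Hom C (sh C N) (sh C P0)\<^esub> (shm C N P0 f0)) = shm C N (sh C A) z"
    using shm_full[OF dt(1) dw(3) dy(6)] by blast
  have t': "(A, P, N, x', y', \<ominus>\<^bsub>Hom C N (sh C A)\<^esub> z) \<in> Tri C"
    by (rule tri_unshift[OF _ A dP(1) dt(1) x'(1) y'(1) z(1)]) (use y(1) x'(2) y'(2) z(2) in simp)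
  let ?v = "Cmp C A P A \<gamma> x'"
  obtain l where l: "?w [^]\<^bsub>End_ring C (sh C A)\<^esub> (l::nat) = zero_mor C (sh C A) (sh C A)"
    using nil by (auto simp: nilpotent_endo_def)
  \<comment> \<open>The shift of \<open>?v\<close> is \<open>?w\<close>, so faithfulness carries
    nilpotency back to \<open>A\<close>.\<close>
  have "shm C A A (?v [^]\<^bsub>End_ring C A\<^esub> l) = shm C A A (zero_mor C A A)"
    using l A dP x' by (simp add: shm_pow shift.map_cmp)
  then have "?v [^]\<^bsub>End_ring C A\<^esub> l = zero_mor C A A"
    by (rule shm_faithful) (use A dP x'(1) in simp_all)
  then have nil': "nilpotent_endo C A ?v"
    using A dP x'(1) by (auto simp: nilpotent_endo_def)
  have "column C A A M P \<alpha> \<beta> ?v (Cmp C A P M \<delta> x') = x'"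
    unfolding column_def using biproduct_decompose(2)[OF bP A M A x'(1)] .
  then have "(A, P, N, column C A A M P \<alpha> \<beta> ?v (Cmp C A P M \<delta> x'), y', \<ominus>\<^bsub>Hom C N (sh C A)\<^esub> z) \<in> Tri C"
    using t' by simp
  moreover have "Cmp C A P M \<delta> x' \<in> mor C A M"
    using A dP M x'(1) by simp
  ultimately show ?thesis
    using bP nil' A by blast
qed

end

theorem theorem1:
  fixes K :: "('k, 'x) ring_scheme"
    and T :: "('k, 'o, 'm) tcat"
  assumes "cring K"
    and "triangulated_category K T"
    and "(idempotents_split T \<and> (\<forall>X\<in>Ob T. artinian_ring (End_ring T X)))
       \<or> (\<exists>(\<kappa> :: 'u rel) (S :: ('k, 'so, 'sm) tcat).
            universe_cardinal \<kappa> \<and> locally_small \<kappa> S \<and> triangulated_category K S \<and>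
            compactly_generated \<kappa> S \<and> algebraic K \<kappa> S TYPE('eo) TYPE('em) \<and>
            triangle_equivalent K T (compact_category \<kappa> S))"
    and "M \<in> Ob T"
    and "N \<in> Ob T"
  shows "(\<exists>Z\<in>Ob T. \<exists>P i1 i2 p1 p2. biproduct T Z M P i1 i2 p1 p2 \<and>
            (\<exists>v u g h. nilpotent_endo T Z v \<and> u \<in> mor T Z M \<and>
               (Z, P, N, column T Z Z M P i1 i2 v u, g, h) \<in> Tri T))
     \<longleftrightarrow> (\<exists>Z\<in>Ob T. \<exists>P i1 i2 p1 p2. biproduct T M Z P i1 i2 p1 p2 \<and>
            (\<exists>u v f h. nilpotent_endo T Z v \<and> u \<in> mor T M Z \<and>
               (N, P, Z, f, row T M Z P Z p1 p2 u v, h) \<in> Tri T))"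
proof -
  interpret triangulated_category K T by (rule assms(2))
  show ?thesis
  proof (rule iffI; elim bexE exE conjE)
    fix Z P i1 i2 p1 p2 v u g h
    assume "biproduct T Z M P i1 i2 p1 p2" "nilpotent_endo T Z v" "u \<in> mor T Z M"
      "(Z, P, N, column T Z Z M P i1 i2 v u, g, h) \<in> Tri T"
    then show "\<exists>Z\<in>Ob T. \<exists>P i1 i2 p1 p2. biproduct T M Z P i1 i2 p1 p2 \<and>
      (\<exists>u v f h. nilpotent_endo T Z v \<and> u \<in> mor T M Z \<and>
        (N, P, Z, f, row T M Z P Z p1 p2 u v, h) \<in> Tri T)"
      by (rule left_triangle_imp_right_triangle[OF assms(4)])
  next
    fix Z P i1 i2 p1 p2 u v f h
    assume "biproduct T M Z P i1 i2 p1 p2" "nilpotent_endo T Z v" "u \<in> mor T M Z"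
      "(N, P, Z, f, row T M Z P Z p1 p2 u v, h) \<in> Tri T"
    then show "\<exists>Z\<in>Ob T. \<exists>P i1 i2 p1 p2. biproduct T Z M P i1 i2 p1 p2 \<and>
      (\<exists>v u g h. nilpotent_endo T Z v \<and> u \<in> mor T Z M \<and>
        (Z, P, N, column T Z Z M P i1 i2 v u, g, h) \<in> Tri T)"
      by (rule right_triangle_imp_left_triangle[OF assms(4)])
  qed
qed

end
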